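(* Let $k\ge 2$ be an integer. The generic $k$-orientation has a transitive extension if and only if $k$ is even.
   Context: **Extensions.** Let $\mathcal M$ be a first-order structure with universe $M$. A one-point extension of $\mathcal M$ is a first-order structure $\mathcal M'$ (in any language) with universe $M\cup\{0\}$, where $0\notin M$ is a new element, such that the stabilizer $\mathrm{Aut}(\mathcal M')_0$ of $0$, acting on $M$, equals $\mathrm{Aut}(\mathcal M)$ as a permutation group on $M$. A transitive extension of $\mathcal M$ is a one-point extension whose automorphism group acts transitively on $M\cup\{0\}$. **Generic structures.** For a Fraïssé class $\mathcal F$ of finitely generated structures, the generic member of $\mathcal F$ is its Fraïssé limit, i.e. the unique (up to isomorphism) countable ultrahomogeneous structure whose age is $\mathcal F$. **$k$-orientations.** A $k$-orientation is a structure with one $k$-ary relation $T$, failing on tuples with repeated entries, such that for any set of $k$ elements, the tuples from the set on which $T$ holds are exactly the orbit of a single repetition-free tuple (an enumeration of the set) under the action of the alternating group $A_k$ permuting coordinates. (So $T$ holds on exactly half of the orderings of each $k$-set; a $2$-orientation is a tournament.) The generic $k$-orientation is the generic member of the class of finite $k$-orientations. *)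

theory Defs
  imports "HOL-Combinatorics.Permutations" "HOL-Library.Countable_Set"
begin

section \<open>First-order structures\<close>

text \<open>
  The symbols of a language are those on which the arity maps are defined; constants are
  nullary function symbols.
\<close>

record ('f, 'r) language =
  fun_arity :: "'f \<rightharpoonup> nat"
  rel_arity :: "'r \<rightharpoonup> nat"

record ('f, 'r, 'a) fo_struct =
  universe :: "'a set"
  func :: "'f \<Rightarrow> 'a list \<Rightarrow> 'a"
  rel :: "'r \<Rightarrow> 'a list \<Rightarrow> bool"

definition tuples :: "'a set \<Rightarrow> nat \<Rightarrow> 'a list set" where
  "tuples A n = {xs. length xs = n \<and> set xs \<subseteq> A}"

definition fun_closed :: "('f, 'r) language \<Rightarrow> ('f, 'r, 'a) fo_struct \<Rightarrow> 'a set \<Rightarrow> bool" where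
  "fun_closed L A B \<longleftrightarrow>
     (\<forall>f n. fun_arity L f = Some n \<longrightarrow> (\<forall>xs \<in> tuples B n. func A f xs \<in> B))"

text \<open>
  The values of \<^const>\<open>func\<close> and \<^const>\<open>rel\<close> at symbols outside the language or at tuples that
  leave the universe or have the wrong length are junk; no definition below depends on them.
  The empty structure is allowed.
\<close>

definition is_structure :: "('f, 'r) language \<Rightarrow> ('f, 'r, 'a) fo_struct \<Rightarrow> bool" where
  "is_structure L A \<longleftrightarrow> fun_closed L A (universe A)"

definition embedding ::
  "('f, 'r) language \<Rightarrow> ('f, 'r, 'a) fo_struct \<Rightarrow> ('f, 'r, 'b) fo_struct \<Rightarrow> ('a \<Rightarrow> 'b) \<Rightarrow> bool"
where
  "embedding L A B h \<longleftrightarrow>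
     h ` universe A \<subseteq> universe B \<and> inj_on h (universe A) \<and>
     (\<forall>f n. fun_arity L f = Some n \<longrightarrow>
        (\<forall>xs \<in> tuples (universe A) n. h (func A f xs) = func B f (map h xs))) \<and>
     (\<forall>r n. rel_arity L r = Some n \<longrightarrow>
        (\<forall>xs \<in> tuples (universe A) n. rel A r xs \<longleftrightarrow> rel B r (map h xs)))"

definition isomorphism ::
  "('f, 'r) language \<Rightarrow> ('f, 'r, 'a) fo_struct \<Rightarrow> ('f, 'r, 'b) fo_struct \<Rightarrow> ('a \<Rightarrow> 'b) \<Rightarrow> bool"
where
  "isomorphism L A B h \<longleftrightarrow> embedding L A B h \<and> h ` universe A = universe B"

text \<open>
  Permutations of the universe are represented by functions that are the identity outside it, so
  that equality of sets of functions is equality of permutation groups.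
\<close>

definition aut :: "('f, 'r) language \<Rightarrow> ('f, 'r, 'a) fo_struct \<Rightarrow> ('a \<Rightarrow> 'a) set" where
  "aut L A = {g. g permutes universe A \<and> isomorphism L A A g}"


section \<open>Generic structures\<close>

definition substructure ::
  "('f, 'r) language \<Rightarrow> ('f, 'r, 'a) fo_struct \<Rightarrow> ('f, 'r, 'a) fo_struct \<Rightarrow> bool"
where
  "substructure L A B \<longleftrightarrow> is_structure L A \<and> embedding L A B id"

definition finitely_generated :: "('f, 'r) language \<Rightarrow> ('f, 'r, 'a) fo_struct \<Rightarrow> bool" where
  "finitely_generated L A \<longleftrightarrow>
     (\<exists>X. finite X \<and> X \<subseteq> universe A \<and>
        (\<forall>B. X \<subseteq> B \<and> B \<subseteq> universe A \<and> fun_closed L A B \<longrightarrow> B = universe A))"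

definition ultrahomogeneous :: "('f, 'r) language \<Rightarrow> ('f, 'r, 'a) fo_struct \<Rightarrow> bool" where
  "ultrahomogeneous L M \<longleftrightarrow>
     (\<forall>A B h. substructure L A M \<and> finitely_generated L A \<and>
              substructure L B M \<and> finitely_generated L B \<and> isomorphism L A B h \<longrightarrow>
        (\<exists>g \<in> aut L M. \<forall>x \<in> universe A. g x = h x))"

text \<open>
  Classes of finitely generated structures are represented by their members whose universe is a
  set of natural numbers. As finitely generated structures over a countable language are
  countable, this represents every isomorphism type.
\<close>

definition age :: "('f, 'r) language \<Rightarrow> ('f, 'r, 'a) fo_struct \<Rightarrow> ('f, 'r, nat) fo_struct set" where
  "age L M = {A. is_structure L A \<and> finitely_generated L A \<and> (\<exists>h. embedding L A M h)}"

definition fraisse_limit ::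
  "('f, 'r) language \<Rightarrow> ('f, 'r, nat) fo_struct set \<Rightarrow> ('f, 'r, 'a) fo_struct \<Rightarrow> bool"
where
  "fraisse_limit L F M \<longleftrightarrow>
     is_structure L M \<and> countable (universe M) \<and> ultrahomogeneous L M \<and> age L M = F"


section \<open>One-point and transitive extensions\<close>

text \<open>
  The new point is \<^const>\<open>None\<close>, and a point \<open>x\<close> of the given structure becomes \<open>Some x\<close>. The
  language of the extension, including its types of symbols, is unrelated to the given one.
\<close>

definition restrict_old :: "('a option \<Rightarrow> 'a option) \<Rightarrow> 'a \<Rightarrow> 'a" where
  "restrict_old g = (\<lambda>x. the (g (Some x)))"

definition one_point_extension ::
  "('f, 'r) language \<Rightarrow> ('f, 'r, 'a) fo_struct \<Rightarrow>
   ('g, 's) language \<Rightarrow> ('g, 's, 'a option) fo_struct \<Rightarrow> bool"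
where
  "one_point_extension L M L' M' \<longleftrightarrow>
     is_structure L' M' \<and> universe M' = insert None (Some ` universe M) \<and>
     restrict_old ` {g \<in> aut L' M'. g None = None} = aut L M"

definition transitive_extension ::
  "('f, 'r) language \<Rightarrow> ('f, 'r, 'a) fo_struct \<Rightarrow>
   ('g, 's) language \<Rightarrow> ('g, 's, 'a option) fo_struct \<Rightarrow> bool"
where
  "transitive_extension L M L' M' \<longleftrightarrow>
     one_point_extension L M L' M' \<and>
     (\<forall>x \<in> universe M'. \<forall>y \<in> universe M'. \<exists>g \<in> aut L' M'. g x = y)"


section \<open>Orientations\<close>

definition orientation_language :: "nat \<Rightarrow> (unit, unit) language" where
  "orientation_language k = \<lparr>fun_arity = Map.empty, rel_arity = [() \<mapsto> k]\<rparr>"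

definition alternating_orbit :: "'a list \<Rightarrow> 'a list set" where
  "alternating_orbit xs = {permute_list p xs | p. p permutes {..<length xs} \<and> evenperm p}"

definition orientation :: "nat \<Rightarrow> (unit, unit, 'a) fo_struct \<Rightarrow> bool" where
  "orientation k A \<longleftrightarrow>
     (\<forall>xs \<in> tuples (universe A) k. rel A () xs \<longrightarrow> distinct xs) \<and>
     (\<forall>S. S \<subseteq> universe A \<and> card S = k \<longrightarrow>
        (\<exists>xs \<in> tuples S k. distinct xs \<and>
           {ys \<in> tuples S k. rel A () ys} = alternating_orbit xs))"

definition generic_orientation :: "nat \<Rightarrow> (unit, unit, 'a) fo_struct \<Rightarrow> bool" where
  "generic_orientation k M \<longleftrightarrow>
     fraisse_limit (orientation_language k) {A. finite (universe A) \<and> orientation k A} M"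

end

theory Submission
  imports Defs
begin

text \<open>
  Write a \<open>k\<close>-orientation as a sign on repetition-free \<open>k\<close>-tuples that flips whenever two adjacent
  entries are swapped. If \<open>M'\<close> is a transitive extension of the generic \<open>k\<close>-orientation, move the first
  entry of a \<open>(k+1)\<close>-tuple to the new point and read off the sign of the rest: this is a well-defined
  invariant of the automorphism group of \<open>M'\<close>, and since that group has only two orbits on
  repetition-free \<open>(k+1)\<close>-tuples, the invariant is again alternating. For odd \<open>k\<close>, the orientation
  induced on \<open>k+1\<close> points by a linear order is preserved by the \<open>(k+1)\<close>-cycle, which therefore extends
  to an automorphism of \<open>M'\<close> although it is an odd permutation: a contradiction.

  For even \<open>k\<close>, the coboundary of the orientation is alternating; together with the orientation itself
  on the tuples through the new point, it is a \<open>(k+1)\<close>-orientation \<open>S\<close> with trivial coboundary.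
  Hence \<open>S\<close> is determined by its link at any single point. Every link has the extension property of
  the generic \<open>k\<close>-orientation, so by back and forth all links are isomorphic, and an isomorphism of
  links extends to an automorphism of \<open>S\<close>.
\<close>

section \<open>Alternating signs\<close>

definition arrangements :: "nat \<Rightarrow> 'a set \<Rightarrow> 'a list set" where
  "arrangements n U = {xs. distinct xs \<and> set xs \<subseteq> U \<and> length xs = n}"

text \<open>Signs are booleans; a product of signs is written with \<open>\<noteq>\<close>, i.e. exclusive or.\<close>

definition alternating :: "nat \<Rightarrow> 'a set \<Rightarrow> ('a list \<Rightarrow> bool) \<Rightarrow> bool" where
  "alternating n U f \<longleftrightarrow>
     (\<forall>us a b vs. us @ a # b # vs \<in> arrangements n U \<longrightarrow>
        f (us @ b # a # vs) \<noteq> f (us @ a # b # vs))"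

lemma alternatingI:
  assumes "\<And>us a b vs. us @ a # b # vs \<in> arrangements n U \<Longrightarrow>
    f (us @ b # a # vs) \<noteq> f (us @ a # b # vs)"
  shows "alternating n U f"
  using assms by (simp add: alternating_def)

lemma alternatingD:
  assumes "alternating n U f" "us @ a # b # vs \<in> arrangements n U"
  shows "f (us @ b # a # vs) = (\<not> f (us @ a # b # vs))"
  using assms by (auto simp: alternating_def)

lemma arrangements_mono: "U \<subseteq> V \<Longrightarrow> arrangements n U \<subseteq> arrangements n V"
  by (auto simp: arrangements_def)

lemma arrangements_Cons [simp]:
  "x # xs \<in> arrangements (Suc n) U \<longleftrightarrow> x \<in> U \<and> xs \<in> arrangements n (U - {x})"
  by (auto simp: arrangements_def)

lemma arrangements_Cons_move:
  "us @ a # vs \<in> arrangements n U \<longleftrightarrow> a # us @ vs \<in> arrangements n U"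
  by (auto simp: arrangements_def)

lemma map_arrangements:
  "xs \<in> arrangements n U \<Longrightarrow> inj_on h U \<Longrightarrow> h ` U \<subseteq> V \<Longrightarrow> map h xs \<in> arrangements n V"
  by (auto simp: arrangements_def distinct_map intro: inj_on_subset)

lemma arrangements_full:
  assumes "xs \<in> arrangements n S" "finite S" "card S = n"
  shows "set xs = S"
proof (rule card_subset_eq)
  show "card (set xs) = card S" using assms distinct_card by (fastforce simp: arrangements_def)
qed (use assms in \<open>auto simp: arrangements_def\<close>)

lemma alternating_subset: "alternating n V f \<Longrightarrow> U \<subseteq> V \<Longrightarrow> alternating n U f"
  unfolding alternating_def using arrangements_mono by blast

lemma alternating_cong:
  assumes "alternating n U f" "\<And>xs. xs \<in> arrangements n U \<Longrightarrow> g xs = f xs"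
  shows "alternating n U g"
proof (rule alternatingI)
  fix us a b vs assume *: "us @ a # b # vs \<in> arrangements n U"
  then have "us @ b # a # vs \<in> arrangements n U" by (auto simp: arrangements_def)
  then show "g (us @ b # a # vs) \<noteq> g (us @ a # b # vs)"
    using alternatingD[OF assms(1) *] assms(2) * by blast
qed

lemma alternating_Cons:
  assumes "alternating (Suc n) U f" "x \<in> U"
  shows "alternating n (U - {x}) (\<lambda>xs. f (x # xs))"
proof (rule alternatingI)
  fix us a b vs assume "us @ a # b # vs \<in> arrangements n (U - {x})"
  then have "(x # us) @ a # b # vs \<in> arrangements (Suc n) U" using assms(2) by simp
  from alternatingD[OF assms(1) this]
  show "f (x # us @ b # a # vs) \<noteq> f (x # us @ a # b # vs)" by simp
qed

lemma alternating_map: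
  assumes "alternating n V f" "inj_on h U" "h ` U \<subseteq> V"
  shows "alternating n U (\<lambda>xs. f (map h xs))"
proof (rule alternatingI)
  fix us a b vs assume "us @ a # b # vs \<in> arrangements n U"
  from map_arrangements[OF this assms(2,3)]
  have "map h us @ h a # h b # map h vs \<in> arrangements n V" by simp
  from alternatingD[OF assms(1) this]
  show "f (map h (us @ b # a # vs)) \<noteq> f (map h (us @ a # b # vs))" by simp
qed

lemma alternating_not: "alternating n U f \<Longrightarrow> alternating n U (\<lambda>xs. \<not> f xs)"
  by (auto simp: alternating_def)

lemma alternating_xor3:
  "alternating n U f \<Longrightarrow> alternating n U g \<Longrightarrow> alternating n U h \<Longrightarrow>
   alternating n U (\<lambda>xs. (f xs \<noteq> g xs) \<noteq> h xs)"
  by (auto simp: alternating_def)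

text \<open>Each entry of \<open>us\<close> is passed by one adjacent swap. The induction peels
  \<open>us\<close> from the right because its last entry is the one next to
  \<open>a\<close>.\<close>

lemma alternating_move:
  assumes "alternating n U f" "us @ a # vs \<in> arrangements n U"
  shows "f (us @ a # vs) = (f (a # us @ vs) \<noteq> odd (length us))"
  using assms(2)
proof (induction us arbitrary: vs rule: rev_induct)
  case (snoc u us)
  have "us @ a # u # vs \<in> arrangements n U"
    using snoc.prems by (auto simp: arrangements_def)
  from alternatingD[OF assms(1) this] snoc.IH[OF this] show ?case by auto
qed simp

text \<open>One value fixes an alternating sign on all orderings of a set: moving the head of
  \<open>xs\<close> to the front of \<open>ys\<close> costs \<open>f\<close> and \<open>g\<close>
  the same factor, and the links at that entry agree by induction.\<close>

lemma alternating_agree: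
  assumes "alternating n U f" "alternating n U g" "xs \<in> arrangements n U" "ys \<in> arrangements n U"
    "set xs = set ys" "f xs = g xs"
  shows "f ys = g ys"
  using assms
proof (induction xs arbitrary: n U ys f g)
  case (Cons x xs)
  obtain us vs where ys: "ys = us @ x # vs" using Cons.prems by (metis list.set_intros(1) split_list)
  obtain m where n: "n = Suc m" using Cons.prems by (cases n) (auto simp: arrangements_def)
  have x: "x \<in> U" using Cons.prems by (auto simp: arrangements_def)
  have xuv: "x # us @ vs \<in> arrangements n U"
    using Cons.prems(4) unfolding ys arrangements_Cons_move .
  have "set xs = set (us @ vs)"
    using Cons.prems(3-5) by (auto simp: ys arrangements_def)
  then have "f (x # us @ vs) = g (x # us @ vs)"
    using Cons.IH[of m "U - {x}" "\<lambda>xs. f (x # xs)" "\<lambda>xs. g (x # xs)" "us @ vs"] Cons.prems xuv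
      alternating_Cons[OF _ x] unfolding n by simp
  then show ?case
    using alternating_move[OF Cons.prems(1)] alternating_move[OF Cons.prems(2)] Cons.prems(4)
    unfolding ys by simp
qed simp

section \<open>Orbits of the alternating group and orientations\<close>

lemma alternating_orbit_distinct:
  assumes "distinct xs" "p permutes {..<length xs}"
  shows "permute_list p xs \<in> alternating_orbit xs \<longleftrightarrow> evenperm p"
proof
  assume "permute_list p xs \<in> alternating_orbit xs"
  then obtain q where q: "q permutes {..<length xs}" "evenperm q"
    "permute_list p xs = permute_list q xs" by (auto simp: alternating_orbit_def)
  have "p i = q i" for i
  proof (cases "i < length xs")
    case True
    then have "xs ! p i = xs ! q i" using q assms(2) by (metis permute_list_nth)
    moreover have "p i < length xs" "q i < length xs"
      using True assms(2) q(1) by (metis lessThan_iff permutes_in_image)+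
    ultimately show ?thesis using assms(1) nth_eq_iff_index_eq by blast
  next
    case False
    then show ?thesis using assms(2) q(1) by (simp add: permutes_not_in)
  qed
  then show "evenperm p" using q(2) by presburger
qed (use assms in \<open>auto simp: alternating_orbit_def\<close>)

text \<open>An adjacent swap in \<open>permute_list p xs\<close> composes \<open>p\<close> with a
  transposition, which changes its parity; as \<open>xs\<close> has no repetitions, that parity
  decides membership in the orbit.\<close>

lemma alternating_alternating_orbit:
  assumes "distinct xs"
  shows "alternating (length xs) (set xs) (\<lambda>ys. ys \<in> alternating_orbit xs)"
proof (rule alternatingI)
  fix us a b vs assume *: "us @ a # b # vs \<in> arrangements (length xs) (set xs)"
  let ?ys = "us @ a # b # vs" and ?zs = "us @ b # a # vs" and ?i = "length us"
  have "set ?ys = set xs"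
    using arrangements_full[OF *] assms by (simp add: distinct_card)
  then have "mset ?ys = mset xs" using * assms
    by (metis (mono_tags, lifting) arrangements_def mem_Collect_eq set_eq_iff_mset_eq_distinct)
  then obtain p where p: "p permutes {..<length xs}" "permute_list p xs = ?ys"
    using mset_eq_permutation by metis
  define t where "t = transpose ?i (Suc ?i)"
  have len: "length xs = length ?ys" using * by (simp add: arrangements_def)
  have t: "t permutes {..<length xs}"
    unfolding t_def by (rule permutes_swap_id) (auto simp: len)
  have "permute_list (p \<circ> t) xs = permute_list t ?ys"
    using permute_list_compose[OF t] p by metis
  also have "\<dots> = ?zs"
  proof (rule nth_equalityI)
    fix j assume "j < length (permute_list t ?ys)"
    then have "permute_list t ?ys ! j = ?ys ! t j" using t len permute_list_nth by (metis length_permute_list)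
    also have "\<dots> = ?zs ! j"
      unfolding t_def transpose_def by (auto simp: nth_append nth_Cons split: nat.splits)
    finally show "permute_list t ?ys ! j = ?zs ! j" .
  qed simp
  finally have zs: "permute_list (p \<circ> t) xs = ?zs" .
  have "evenperm (p \<circ> t) \<longleftrightarrow> \<not> evenperm p"
    using evenperm_comp[of p t] permutes_imp_permutation[OF _ p(1)] permutes_imp_permutation[OF _ t]
    by (auto simp: t_def evenperm_swap)
  then show "(?zs \<in> alternating_orbit xs) \<noteq> (?ys \<in> alternating_orbit xs)"
    using alternating_orbit_distinct[OF assms p(1)]
      alternating_orbit_distinct[OF assms permutes_compose[OF t p(1)]] p(2) zs by simp
qed

lemma alternating_orbit_tuples:
  "alternating_orbit xs \<subseteq> {ys. length ys = length xs \<and> set ys = set xs}"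
  by (auto simp: alternating_orbit_def)

text \<open>Links the definition by orbits to the calculus of signs. From left to right, the
  relation on a \<open>k\<close>-set is membership in an orbit. From right to left, one of two
  orderings differing by a swap has the value \<open>True\<close>; its orbit and the relation are
  both alternating and agree there, hence on all orderings of the set.\<close>

lemma orientation_iff_alternating:
  assumes "k \<ge> 2"
  shows "orientation k A \<longleftrightarrow>
    (\<forall>xs \<in> tuples (universe A) k. rel A () xs \<longrightarrow> distinct xs) \<and>
    alternating k (universe A) (rel A ())"
proof (intro iffI conjI)
  assume A: "orientation k A"
  show "alternating k (universe A) (rel A ())"
  proof (rule alternatingI)
    fix us a b vs assume *: "us @ a # b # vs \<in> arrangements k (universe A)"
    let ?ys = "us @ a # b # vs" and ?zs = "us @ b # a # vs"
    have ys: "distinct ?ys" "set ?ys \<subseteq> universe A" "length ?ys = k"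
      using * by (auto simp: arrangements_def)
    then have "card (set ?ys) = k" by (metis distinct_card)
    with A ys(2) have "\<exists>xs \<in> tuples (set ?ys) k. distinct xs \<and>
        {ys \<in> tuples (set ?ys) k. rel A () ys} = alternating_orbit xs"
      unfolding orientation_def by blast
    then obtain xs where xs: "xs \<in> tuples (set ?ys) k" "distinct xs"
      "{ys \<in> tuples (set ?ys) k. rel A () ys} = alternating_orbit xs" by blast
    have "set xs = set ?ys"
      using xs(1,2) \<open>card (set ?ys) = k\<close>
      by (intro arrangements_full[of _ k]) (auto simp: tuples_def arrangements_def)
    then have "alternating k (set ?ys) (\<lambda>ys. ys \<in> alternating_orbit xs)"
      using alternating_alternating_orbit[OF xs(2)] xs(1) by (simp add: tuples_def)
    moreover have "?ys \<in> arrangements k (set ?ys)" using ys by (simp add: arrangements_def)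
    ultimately have "(?zs \<in> alternating_orbit xs) = (?ys \<notin> alternating_orbit xs)"
      using alternatingD by metis
    moreover have "?ys \<in> tuples (set ?ys) k" "?zs \<in> tuples (set ?ys) k"
      using ys by (auto simp: tuples_def)
    ultimately show "rel A () ?zs \<noteq> rel A () ?ys" using xs(3) by blast
  qed
next
  assume A: "(\<forall>xs \<in> tuples (universe A) k. rel A () xs \<longrightarrow> distinct xs) \<and>
    alternating k (universe A) (rel A ())"
  show "orientation k A"
    unfolding orientation_def
  proof (intro conjI allI impI)
    fix S assume S: "S \<subseteq> universe A \<and> card S = k"
    then have "finite S" using assms by (auto intro: card_ge_0_finite)
    then obtain ws where ws: "set ws = S" "distinct ws" using finite_distinct_list by blast
    then have "length ws = k" using S distinct_card by fastforce
    \<comment> \<open>The case rule of \<open>remdups_adj\<close> is borrowed to split lists by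
      length 0, 1 and at least 2. Here \<open>k \<ge> 2\<close> provides a swap.\<close>
    then obtain a b vs where ws_eq: "ws = [] @ a # b # vs"
      using assms by (cases ws rule: remdups_adj.cases) auto
    have alt: "alternating k S (rel A ())" using A S alternating_subset by blast
    moreover have wsk: "[] @ a # b # vs \<in> arrangements k S"
      using ws \<open>length ws = k\<close> ws_eq by (auto simp: arrangements_def)
    ultimately have "rel A () ([] @ b # a # vs) = (\<not> rel A () ([] @ a # b # vs))"
      by (rule alternatingD)
    then obtain xs where xs: "xs \<in> {a # b # vs, b # a # vs}" "rel A () xs" by auto
    then have xs': "distinct xs" "set xs = S" "length xs = k"
      using ws \<open>length ws = k\<close> ws_eq by auto
    have "rel A () xs = (xs \<in> alternating_orbit xs)"
      using xs(2) xs'(1) alternating_orbit_distinct[of xs id]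
      by (simp add: permutes_id evenperm_id)
    then have eq: "rel A () ys = (ys \<in> alternating_orbit xs)" if "ys \<in> arrangements k S" "set ys = S" for ys
      using alternating_agree[OF alt, of "\<lambda>ys. ys \<in> alternating_orbit xs" xs ys]
        alternating_alternating_orbit[OF xs'(1)] xs' that by (auto simp: arrangements_def)
    have full: "ys \<in> arrangements k S \<and> set ys = S" if "ys \<in> tuples S k" "distinct ys" for ys
      using that S \<open>finite S\<close> arrangements_full[of ys k S]
      by (auto simp: arrangements_def tuples_def)
    have "{ys \<in> tuples S k. rel A () ys} = alternating_orbit xs"
    proof (intro equalityI subsetI)
      fix ys assume ys: "ys \<in> {ys \<in> tuples S k. rel A () ys}"
      then have "ys \<in> tuples (universe A) k" using S by (auto simp: tuples_def)
      then have "distinct ys" using A ys by blast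
      then show "ys \<in> alternating_orbit xs" using full eq ys by blast
    next
      fix ys assume ys: "ys \<in> alternating_orbit xs"
      then have "distinct ys" using xs'(1) by (auto simp: alternating_orbit_def)
      moreover have "ys \<in> tuples S k"
        using ys alternating_orbit_tuples[of xs] xs' by (auto simp: tuples_def)
      ultimately show "ys \<in> {ys \<in> tuples S k. rel A () ys}" using full eq ys by blast
    qed
    then show "\<exists>xs \<in> tuples S k. distinct xs \<and>
           {ys \<in> tuples S k. rel A () ys} = alternating_orbit xs"
      using xs' by (intro bexI[of _ xs]) (auto simp: tuples_def)
  qed (use A in auto)
qed (auto simp: orientation_def)

section \<open>The coboundary and the gluing of signs\<close>

text \<open>
  \<open>delta f [x\<^sub>0, \<dots>, x\<^sub>n]\<close> is the coboundary: the product of the signs of the lists obtained by deleting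
  one entry. \<open>insertion c\<close> turns a sign \<open>f\<close> into the alternating sign on lists through \<open>c\<close> with
  \<open>c # ys \<mapsto> f ys\<close>; its value on lists that avoid \<open>c\<close> is junk.
\<close>

fun delta :: "('a list \<Rightarrow> bool) \<Rightarrow> 'a list \<Rightarrow> bool" where
  "delta f [] = False"
| "delta f (x # xs) = (f xs \<noteq> delta (\<lambda>ys. f (x # ys)) xs)"

fun insertion :: "'a \<Rightarrow> ('a list \<Rightarrow> bool) \<Rightarrow> 'a list \<Rightarrow> bool" where
  "insertion c f [] = False"
| "insertion c f (x # xs) = (if x = c then f xs else \<not> insertion c (\<lambda>ys. f (x # ys)) xs)"

lemma delta_cong:
  assumes "\<And>ys. ys \<in> arrangements n V \<Longrightarrow> f ys = g ys" "xs \<in> arrangements (Suc n) V"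
  shows "delta f xs = delta g xs"
  using assms
proof (induction xs arbitrary: n V f g)
  case (Cons x xs)
  show ?case
  proof (cases n)
    case 0
    then show ?thesis using Cons.prems by (auto simp: arrangements_def)
  next
    case (Suc m)
    have "delta (\<lambda>ys. f (x # ys)) xs = delta (\<lambda>ys. g (x # ys)) xs"
      using Cons.prems Suc by (intro Cons.IH[where V = "V - {x}" and n = m]) auto
    moreover have "f xs = g xs"
      using Cons.prems by (intro Cons.prems(1)) (auto simp: arrangements_def)
    ultimately show ?thesis by simp
  qed
qed simp

lemma delta_xor: "delta (\<lambda>ys. f ys \<noteq> g ys) xs = (delta f xs \<noteq> delta g xs)"
proof (induction xs arbitrary: f g)
  case (Cons x xs)
  show ?case by (simp only: delta.simps Cons.IH) blast
qed simp

lemma delta_const: "delta (\<lambda>_. c) xs = (c \<and> odd (length xs))"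
  by (induction xs) auto

text \<open>Modulo 2 no alternation is required. Expanding at the head, two copies of
  \<open>delta f xs\<close> cancel by additivity, which leaves the double coboundary of
  \<open>\<lambda>ys. f (x # ys)\<close> at \<open>xs\<close>.\<close>

lemma delta_delta: "\<not> delta (delta f) xs"
proof (induction xs arbitrary: f)
  case (Cons x xs)
  have "delta (delta f) (x # xs) =
      (delta f xs \<noteq> delta (\<lambda>ys. f ys \<noteq> delta (\<lambda>zs. f (x # zs)) ys) xs)"
    by (simp only: delta.simps)
  then show ?case unfolding delta_xor using Cons.IH by blast
qed simp

lemma delta_not: "delta (\<lambda>ys. \<not> f ys) xs = (delta f xs \<noteq> odd (length xs))"
  using delta_xor[of f "\<lambda>_. True" xs] by (simp add: delta_const)

lemma delta_map: "delta (\<lambda>ys. f (map h ys)) xs = delta f (map h xs)"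
proof (induction xs arbitrary: f)
  case (Cons x xs)
  show ?case by (simp add: Cons.IH[of "\<lambda>ys. f (h x # ys)"])
qed simp

text \<open>The two terms that delete \<open>a\<close> or \<open>b\<close> are merely exchanged;
  each of the other \<open>length (us @ vs)\<close> terms flips.\<close>

lemma delta_swap:
  assumes "alternating n U f" "us @ a # b # vs \<in> arrangements (Suc n) U"
  shows "delta f (us @ b # a # vs) = (delta f (us @ a # b # vs) \<noteq> odd (length (us @ vs)))"
  using assms
proof (induction us arbitrary: n U f)
  case Nil
  show ?case
  proof (cases vs)
    case Nil then show ?thesis by auto
  next
    case (Cons v ws)
    then obtain m where n: "n = Suc (Suc m)"
      using Nil.prems by (cases n; cases "n - 1") (auto simp: arrangements_def)
    have "delta (\<lambda>ys. f (b # a # ys)) vs = delta (\<lambda>ys. \<not> f (a # b # ys)) vs"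
    proof (rule delta_cong[where n = m and V = "U - {a} - {b}"])
      fix ys assume "ys \<in> arrangements m (U - {a} - {b})"
      then show "f (b # a # ys) = (\<not> f (a # b # ys))"
        using alternatingD[OF Nil.prems(1), of "[]" a b ys] Nil.prems(2) n by auto
    qed (use Nil.prems(2) n in auto)
    then show ?thesis by (auto simp: delta_not)
  qed
next
  case (Cons u us)
  obtain m where n: "n = Suc m" using Cons.prems by (cases n) (auto simp: arrangements_def)
  have u: "u \<in> U" and us: "us @ a # b # vs \<in> arrangements n (U - {u})" using Cons.prems by auto
  then have "us @ a # b # vs \<in> arrangements n U" by (auto simp: arrangements_def)
  from alternatingD[OF Cons.prems(1) this]
  show ?case using Cons.IH[OF alternating_Cons[OF _ u], of m f] Cons.prems(1) us n by auto
qed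

text \<open>The \<open>n - 1\<close> terms that keep both swapped entries flip, and this number is
  odd because \<open>n\<close> is even.\<close>

lemma alternating_delta:
  assumes "alternating n U f" "even n"
  shows "alternating (Suc n) U (delta f)"
proof (rule alternatingI)
  fix us a b vs assume *: "us @ a # b # vs \<in> arrangements (Suc n) U"
  then have "odd (length (us @ vs))" using assms(2) by (auto simp: arrangements_def)
  then show "delta f (us @ b # a # vs) \<noteq> delta f (us @ a # b # vs)"
    using delta_swap[OF assms(1) *] by auto
qed

lemma insertion_append:
  "c \<notin> set us \<Longrightarrow> insertion c f (us @ c # vs) = (f (us @ vs) \<noteq> odd (length us))"
  by (induction us arbitrary: f) auto

text \<open>Glues a sign from its link \<open>f\<close> at \<open>c\<close> and its restriction
  \<open>g\<close> to \<open>U\<close>. A swap not involving \<open>c\<close> is a swap for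
  \<open>f\<close> or \<open>g\<close>; a swap involving \<open>c\<close> shifts the position of
  \<open>c\<close> by one and so flips the factor in \<open>insertion_append\<close>.\<close>

lemma alternating_insertion:
  assumes "alternating n U f" "alternating (Suc n) U g" "c \<notin> U"
  shows "alternating (Suc n) (insert c U) (\<lambda>xs. if c \<in> set xs then insertion c f xs else g xs)"
    (is "alternating _ _ ?h")
proof (rule alternatingI)
  fix us a b vs assume *: "us @ a # b # vs \<in> arrangements (Suc n) (insert c U)"
  let ?xs = "us @ a # b # vs"
  have len: "length (us @ vs) + 1 = n" and dist: "distinct ?xs"
    and sub: "set ?xs \<subseteq> insert c U" using * by (auto simp: arrangements_def)
  have ins: "?h (ps @ c # qs) = (f (ps @ qs) \<noteq> odd (length ps))" if "distinct (ps @ c # qs)" for ps qs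
    using insertion_append[of c ps f qs] that by simp
  consider (a) "a = c" | (b) "b = c" | (us) "c \<in> set us" | (vs) "c \<in> set vs" | (none) "c \<notin> set ?xs"
    by auto
  then show "?h (us @ b # a # vs) \<noteq> ?h (us @ a # b # vs)"
  proof cases
    case a
    have "distinct (us @ c # b # vs)" "distinct ((us @ [b]) @ c # vs)" using dist a by auto
    note this[THEN ins]
    moreover have "odd (length (us @ [b])) = (\<not> odd (length us))" by simp
    ultimately show ?thesis unfolding a append_assoc append_Cons append_Nil by blast
  next
    case b
    have "distinct (us @ c # a # vs)" "distinct ((us @ [a]) @ c # vs)" using dist b by auto
    note this[THEN ins]
    moreover have "odd (length (us @ [a])) = (\<not> odd (length us))" by simp
    ultimately show ?thesis unfolding b append_assoc append_Cons append_Nil by blast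
  next
    case us
    then obtain u1 u2 where u: "us = u1 @ c # u2" by (meson split_list)
    have "(u1 @ u2) @ a # b # vs \<in> arrangements n U"
      using dist sub len by (auto simp: arrangements_def u)
    then have "f (u1 @ u2 @ b # a # vs) = (\<not> f (u1 @ u2 @ a # b # vs))"
      using alternatingD[OF assms(1)] by fastforce
    moreover have "distinct (u1 @ c # u2 @ a # b # vs)" "distinct (u1 @ c # u2 @ b # a # vs)"
      using dist u by auto
    note this[THEN ins]
    ultimately show ?thesis unfolding u append_assoc append_Cons by blast
  next
    case vs
    then obtain v1 v2 where v: "vs = v1 @ c # v2" by (meson split_list)
    have "us @ a # b # v1 @ v2 \<in> arrangements n U"
      using dist sub len by (auto simp: arrangements_def v)
    then have "f (us @ b # a # v1 @ v2) = (\<not> f (us @ a # b # v1 @ v2))"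
      using alternatingD[OF assms(1)] by blast
    moreover have "distinct ((us @ a # b # v1) @ c # v2)" "distinct ((us @ b # a # v1) @ c # v2)"
      using dist v by auto
    note this[THEN ins]
    moreover have "length (us @ a # b # v1) = length (us @ b # a # v1)" by simp
    ultimately show ?thesis unfolding v append_assoc append_Cons by metis
  next
    case none
    then have "?xs \<in> arrangements (Suc n) U" using * by (auto simp: arrangements_def)
    from alternatingD[OF assms(2) this]
    have "g (us @ b # a # vs) = (\<not> g (us @ a # b # vs))" .
    moreover have "c \<notin> set (us @ b # a # vs)" using none by simp
    ultimately show ?thesis using none by presburger
  qed
qed

section \<open>Back and forth\<close>

text \<open>Stage \<open>n + 1\<close> of an increasing chain in \<open>P\<close> has the
  \<open>n\<close>-th point of \<open>U\<close> in its domain and the \<open>n\<close>-th point of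
  \<open>V\<close> in its range. The union is the graph of \<open>h\<close>, and each finite set is
  already covered at a single stage, which is what carries finitary properties of \<open>P\<close>
  over to \<open>h\<close>.\<close>

lemma back_and_forth:
  assumes "countable U" "countable V" "P p0"
    and P: "\<And>p. P p \<Longrightarrow> p \<subseteq> U \<times> V \<and> single_valued p \<and> single_valued (p\<inverse>)"
    and forward: "\<And>p u. P p \<Longrightarrow> u \<in> U \<Longrightarrow> \<exists>q. P q \<and> p \<subseteq> q \<and> u \<in> Domain q"
    and backward: "\<And>p v. P p \<Longrightarrow> v \<in> V \<Longrightarrow> \<exists>q. P q \<and> p \<subseteq> q \<and> v \<in> Range q"
  obtains h where "bij_betw h U V"
    "\<And>F. finite F \<Longrightarrow> F \<subseteq> U \<Longrightarrow> \<exists>p. P p \<and> (\<forall>x\<in>F. (x, h x) \<in> p)"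
proof -
  \<comment> \<open>The guards matter only for empty \<open>U\<close> or \<open>V\<close>, where
    \<open>from_nat_into\<close> has an arbitrary value.\<close>
  define Q where "Q n p q \<longleftrightarrow> p \<subseteq> q \<and> (from_nat_into U n \<in> U \<longrightarrow> from_nat_into U n \<in> Domain q)
    \<and> (from_nat_into V n \<in> V \<longrightarrow> from_nat_into V n \<in> Range q)" for n and p q :: "('a \<times> 'b) set"
  have step: "\<exists>q. P q \<and> Q n p q" if p: "P p" for n p
  proof -
    obtain q where q: "P q" "p \<subseteq> q" "from_nat_into U n \<in> U \<longrightarrow> from_nat_into U n \<in> Domain q"
      using forward[OF p] p by blast
    obtain r where r: "P r" "q \<subseteq> r" "from_nat_into V n \<in> V \<longrightarrow> from_nat_into V n \<in> Range r"
      using backward[OF q(1)] q(1) by blast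
    have "Domain q \<subseteq> Domain r" using r(2) by blast
    then show ?thesis using q r unfolding Q_def by blast
  qed
  have "\<exists>c. \<forall>n. P (c n) \<and> Q n (c n) (c (Suc n))"
    by (rule dependent_nat_choice) (use \<open>P p0\<close> step in blast)+
  then obtain c where c: "\<And>n. P (c n)" "\<And>n. Q n (c n) (c (Suc n))" by blast
  have mono: "m \<le> n \<Longrightarrow> c m \<subseteq> c n" for m n
    by (rule lift_Suc_mono_le[of c]) (use c(2) in \<open>auto simp: Q_def\<close>)
  have dom: "\<exists>n v. (u, v) \<in> c n" if "u \<in> U" for u
    using from_nat_into_surj[OF \<open>countable U\<close> that] c(2) that unfolding Q_def by blast
  have ran: "\<exists>n u. (u, v) \<in> c n" if "v \<in> V" for v
    using from_nat_into_surj[OF \<open>countable V\<close> that] c(2) that unfolding Q_def by blast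
  have uniq: "(u = u') = (v = v')" if "(u, v) \<in> c m" "(u', v') \<in> c n" for u v u' v' m n
  proof -
    have "(u, v) \<in> c (max m n)" "(u', v') \<in> c (max m n)"
      using that mono[of m "max m n"] mono[of n "max m n"] by auto
    moreover have "single_valued (c (max m n))" "single_valued ((c (max m n))\<inverse>)"
      using P[OF c(1)] by auto
    ultimately show ?thesis unfolding single_valued_def by blast
  qed
  from dom have "\<forall>u\<in>U. \<exists>v n. (u, v) \<in> c n" by blast
  from bchoice[OF this] obtain h where h: "\<And>u. u \<in> U \<Longrightarrow> \<exists>n. (u, h u) \<in> c n" by blast
  have sub: "c n \<subseteq> U \<times> V" for n using P c(1) by blast
  have bij: "bij_betw h U V"
  proof (rule bij_betwI')
    show "(h x = h y) = (x = y)" if "x \<in> U" "y \<in> U" for x y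
      using h[OF that(1)] h[OF that(2)] uniq by metis
    show "h x \<in> V" if "x \<in> U" for x using h[OF that] sub by blast
    show "\<exists>x\<in>U. v = h x" if v: "v \<in> V" for v
    proof -
      obtain n u where u: "(u, v) \<in> c n" using ran[OF v] by blast
      then have "u \<in> U" using sub by blast
      then show ?thesis using h u uniq by metis
    qed
  qed
  have cover: "\<exists>n. \<forall>x\<in>F. (x, h x) \<in> c n" if "finite F" "F \<subseteq> U" for F
    using that
  proof (induction F)
    case (insert x F)
    then obtain m n where "(x, h x) \<in> c m" "\<forall>x\<in>F. (x, h x) \<in> c n" using h by blast
    then have "\<forall>y\<in>insert x F. (y, h y) \<in> c (max m n)"
      using mono[of m "max m n"] mono[of n "max m n"] by auto
    then show ?case by blast
  qed simp
  show thesis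
  proof (rule that[OF bij])
    fix F assume "finite F" "F \<subseteq> U"
    from cover[OF this] obtain n where "\<forall>x\<in>F. (x, h x) \<in> c n" ..
    with c(1) show "\<exists>p. P p \<and> (\<forall>x\<in>F. (x, h x) \<in> p)" by blast
  qed
qed

text \<open>A relation rather than a function, so that the back step is the forth step for the
  converse. An arrangement of pairs records a list together with its image.\<close>

definition partial_iso ::
  "nat \<Rightarrow> 'a set \<Rightarrow> ('a list \<Rightarrow> bool) \<Rightarrow> 'b set \<Rightarrow> ('b list \<Rightarrow> bool) \<Rightarrow> ('a \<times> 'b) set \<Rightarrow> bool"
where
  "partial_iso n U f V g p \<longleftrightarrow> finite p \<and> p \<subseteq> U \<times> V \<and> single_valued p \<and> single_valued (p\<inverse>) \<and>
     (\<forall>qs \<in> arrangements n p. f (map fst qs) = g (map snd qs))"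

text \<open>
  Only sets \<open>X\<close> containing the base point \<open>c\<close> are considered, as the prescribed signs at the new
  vertex are easier to translate between a link and \<open>M\<close> if \<open>X\<close> contains the point at infinity.
\<close>

definition extension_property :: "nat \<Rightarrow> 'a set \<Rightarrow> 'a \<Rightarrow> ('a list \<Rightarrow> bool) \<Rightarrow> bool" where
  "extension_property n U c f \<longleftrightarrow>
     (\<forall>X \<phi>. finite X \<and> c \<in> X \<and> X \<subseteq> U \<and> alternating n X \<phi> \<longrightarrow>
        (\<exists>b \<in> U - X. \<forall>ys \<in> arrangements n X. f (b # ys) = \<phi> ys))"

lemma partial_iso_converse:
  assumes "partial_iso n U f V g p"
  shows "partial_iso n V g U f (p\<inverse>)"
proof -
  have "g (map fst qs) = f (map snd qs)" if qs: "qs \<in> arrangements n (p\<inverse>)" for qs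
  proof -
    have "map prod.swap qs \<in> arrangements n p"
      using qs by (intro map_arrangements[of _ _ "p\<inverse>"]) auto
    then have "f (map fst (map prod.swap qs)) = g (map snd (map prod.swap qs))"
      using assms unfolding partial_iso_def by blast
    then show ?thesis by (simp add: comp_def)
  qed
  then show ?thesis using assms unfolding partial_iso_def by auto
qed

text \<open>The image \<open>b\<close> of \<open>u\<close> has to satisfy
  \<open>g (b # ys) = f (u # map r ys)\<close> on the range of \<open>p\<close>, where
  \<open>r\<close> inverts \<open>p\<close>. These prescribed values are alternating, so the
  extension property yields \<open>b\<close>; the pair \<open>(c, d)\<close> puts the base point
  into the range. Lists through the new pair are compared after moving it to the front.\<close>

lemma partial_iso_forth:
  assumes f: "alternating (Suc n) U f" and g: "alternating (Suc n) V g"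
    and ext: "extension_property n V d g" and p: "partial_iso (Suc n) U f V g p"
    and cd: "(c, d) \<in> p" and u: "u \<in> U"
  shows "\<exists>q. partial_iso (Suc n) U f V g q \<and> p \<subseteq> q \<and> u \<in> Domain q"
proof (cases "u \<in> Domain p")
  case True
  then show ?thesis using p by blast
next
  case False
  define X where "X = Range p"
  have fin: "finite p" and sub: "p \<subseteq> U \<times> V" and sv: "single_valued p" and svc: "single_valued (p\<inverse>)"
    and pres: "\<And>qs. qs \<in> arrangements (Suc n) p \<Longrightarrow> f (map fst qs) = g (map snd qs)"
    using p unfolding partial_iso_def by blast+
  have injs: "inj_on fst p" "inj_on snd p"
    using sv svc unfolding inj_on_def single_valued_def by force+
  define r where "r = fst \<circ> the_inv_into p snd"
  have r: "r y = x" if "(x, y) \<in> p" for x y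
    unfolding r_def using the_inv_into_f_f[OF injs(2) that] by simp
  have "finite X" "d \<in> X" "X \<subseteq> V" using fin cd sub finite_Range by (auto simp: X_def)
  moreover have "alternating n X (\<lambda>ys. f (u # map r ys))"
  proof (rule alternating_map[OF alternating_Cons[OF f u]])
    show "inj_on r X" using r sv by (fastforce simp: X_def inj_on_def single_valued_def)
    show "r ` X \<subseteq> U - {u}" using r sub False by (auto simp: X_def)
  qed
  ultimately have "\<exists>b \<in> V - X. \<forall>ys \<in> arrangements n X. g (b # ys) = f (u # map r ys)"
    by (intro ext[unfolded extension_property_def, rule_format]) simp
  then obtain b where b: "b \<in> V - X"
    "\<And>ys. ys \<in> arrangements n X \<Longrightarrow> g (b # ys) = f (u # map r ys)" by blast
  let ?q = "insert (u, b) p"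
  have "f (map fst qs) = g (map snd qs)" if qs: "qs \<in> arrangements (Suc n) ?q" for qs
  proof (cases "(u, b) \<in> set qs")
    case False
    then show ?thesis using pres qs by (auto simp: arrangements_def)
  next
    case True
    then obtain s t where st: "qs = s @ (u, b) # t" by (meson split_list)
    then have st_p: "s @ t \<in> arrangements n p" using qs by (auto simp: arrangements_def)
    have fst_st: "map fst (s @ t) \<in> arrangements n (U - {u})"
      using sub False \<open>u \<notin> Domain p\<close> by (intro map_arrangements[OF st_p injs(1)]) auto
    have snd_st: "map snd (s @ t) \<in> arrangements n X"
      by (intro map_arrangements[OF st_p injs(2)]) (auto simp: X_def)
    then have snd_st': "map snd (s @ t) \<in> arrangements n (V - {b})"
      using b(1) \<open>X \<subseteq> V\<close> arrangements_mono[of X "V - {b}"] by blast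
    have "map r (map snd (s @ t)) = map fst (s @ t)"
      using st_p r by (auto simp: arrangements_def)
    then have "g (b # map snd (s @ t)) = f (u # map fst (s @ t))"
      using b(2)[OF snd_st] by metis
    moreover have "map fst s @ u # map fst t \<in> arrangements (Suc n) U"
      "map snd s @ b # map snd t \<in> arrangements (Suc n) V"
      using fst_st snd_st' u b(1) unfolding arrangements_Cons_move by auto
    ultimately show ?thesis
      using alternating_move[OF f, of "map fst s"] alternating_move[OF g, of "map snd s"] st by simp
  qed
  moreover have "single_valued ?q" "single_valued (?q\<inverse>)"
    using sv svc False b(1) unfolding single_valued_def X_def by auto
  ultimately have "partial_iso (Suc n) U f V g ?q"
    using fin sub u b(1) unfolding partial_iso_def by auto
  then show ?thesis by blast
qed

lemma alternating_iso:
  assumes "countable U" "countable V" "n \<ge> 1"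
    and f: "alternating (Suc n) U f" "extension_property n U c f" "c \<in> U"
    and g: "alternating (Suc n) V g" "extension_property n V d g" "d \<in> V"
  obtains h where "bij_betw h U V" "\<And>xs. xs \<in> arrangements (Suc n) U \<Longrightarrow> g (map h xs) = f xs"
proof -
  let ?P = "\<lambda>p. partial_iso (Suc n) U f V g p \<and> (c, d) \<in> p"
  \<comment> \<open>Signs take at least two entries, so the pair of base points alone is a partial
    isomorphism vacuously.\<close>
  have "arrangements (Suc n) {(c, d)} = {}"
    using \<open>n \<ge> 1\<close> by (auto simp: arrangements_def subset_singleton_iff length_Suc_conv)
  then have init: "?P {(c, d)}" using f g by (auto simp: partial_iso_def single_valued_def)
  have sub: "p \<subseteq> U \<times> V \<and> single_valued p \<and> single_valued (p\<inverse>)" if "?P p" for p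
    using that by (auto simp: partial_iso_def)
  have forward: "\<exists>q. ?P q \<and> p \<subseteq> q \<and> u \<in> Domain q" if "?P p" "u \<in> U" for p u
    using partial_iso_forth[OF f(1) g(1,2)] that by (meson subsetD)
  have backward: "\<exists>q. ?P q \<and> p \<subseteq> q \<and> v \<in> Range q" if "?P p" "v \<in> V" for p v
  proof -
    have "partial_iso (Suc n) V g U f (p\<inverse>)" "(d, c) \<in> p\<inverse>"
      using that partial_iso_converse by auto
    from partial_iso_forth[OF g(1) f(1,2) this \<open>v \<in> V\<close>] obtain q where
      q: "partial_iso (Suc n) V g U f q" "p\<inverse> \<subseteq> q" "v \<in> Domain q" by blast
    then show ?thesis using that(1) partial_iso_converse[OF q(1)]
      by (intro exI[of _ "q\<inverse>"]) auto
  qed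
  show thesis
  proof (rule back_and_forth[OF assms(1,2), of ?P, OF init sub forward backward])
    fix h assume bij: "bij_betw h U V"
      and h: "\<And>F. finite F \<Longrightarrow> F \<subseteq> U \<Longrightarrow> \<exists>p. ?P p \<and> (\<forall>x\<in>F. (x, h x) \<in> p)"
    show thesis
    proof (rule that[OF bij])
      fix xs assume xs: "xs \<in> arrangements (Suc n) U"
      obtain p where p: "partial_iso (Suc n) U f V g p" "\<forall>x\<in>set xs. (x, h x) \<in> p"
        using h[of "set xs"] xs by (auto simp: arrangements_def)
      have "map (\<lambda>x. (x, h x)) xs \<in> arrangements (Suc n) p"
        using p(2) xs by (auto simp: arrangements_def distinct_map inj_on_def)
      then have "f (map fst (map (\<lambda>x. (x, h x)) xs)) = g (map snd (map (\<lambda>x. (x, h x)) xs))"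
        using p(1) unfolding partial_iso_def by blast
      then show "g (map h xs) = f xs" by (simp add: comp_def)
    qed
  qed
qed

section \<open>The generic orientation\<close>

lemma embedding_orientation_language:
  "embedding (orientation_language k) A B h \<longleftrightarrow>
     h ` universe A \<subseteq> universe B \<and> inj_on h (universe A) \<and>
     (\<forall>xs \<in> tuples (universe A) k. rel A () xs \<longleftrightarrow> rel B () (map h xs))"
  by (auto simp: embedding_def orientation_language_def)

lemma is_structure_orientation_language: "is_structure (orientation_language k) A"
  by (simp add: is_structure_def fun_closed_def orientation_language_def)

lemma finitely_generated_finite: "finite (universe A) \<Longrightarrow> finitely_generated L A"
  by (auto simp: finitely_generated_def)

lemma aut_iff_preserves:
  "g \<in> aut L A \<longleftrightarrow> g permutes universe A \<and>
     (\<forall>f n. fun_arity L f = Some n \<longrightarrow>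
        (\<forall>xs \<in> tuples (universe A) n. g (func A f xs) = func A f (map g xs))) \<and>
     (\<forall>r n. rel_arity L r = Some n \<longrightarrow>
        (\<forall>xs \<in> tuples (universe A) n. rel A r xs \<longleftrightarrow> rel A r (map g xs)))"
proof (cases "g permutes universe A")
  case True
  then show ?thesis
    by (simp only: aut_def isomorphism_def embedding_def mem_Collect_eq permutes_image[OF True]
        permutes_inj_on[OF True] order_refl simp_thms)
qed (simp add: aut_def)

lemma aut_orientation_language:
  "g \<in> aut (orientation_language k) A \<longleftrightarrow>
     g permutes universe A \<and> (\<forall>xs \<in> tuples (universe A) k. rel A () xs \<longleftrightarrow> rel A () (map g xs))"
  by (auto simp: aut_iff_preserves orientation_language_def)

lemma aut_permutes: "g \<in> aut L A \<Longrightarrow> g permutes universe A"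
  by (simp add: aut_def)

lemma map_tuples: "xs \<in> tuples A n \<Longrightarrow> g ` A \<subseteq> B \<Longrightarrow> map g xs \<in> tuples B n"
  by (auto simp: tuples_def)

lemma map_tuples_permutes: "xs \<in> tuples A n \<Longrightarrow> g permutes A \<Longrightarrow> map g xs \<in> tuples A n"
  by (rule map_tuples) (auto simp: permutes_in_image)

lemma aut_comp:
  assumes "g \<in> aut L A" "h \<in> aut L A"
  shows "g \<circ> h \<in> aut L A"
proof -
  have gh: "g permutes universe A" "h permutes universe A" using assms aut_permutes by auto
  have "(g \<circ> h) (func A f xs) = func A f (map (g \<circ> h) xs)"
    if "fun_arity L f = Some n" "xs \<in> tuples (universe A) n" for f n xs
    using assms that map_tuples_permutes[OF that(2) gh(2)] by (simp add: aut_iff_preserves)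
  moreover have "rel A r xs = rel A r (map (g \<circ> h) xs)"
    if "rel_arity L r = Some n" "xs \<in> tuples (universe A) n" for r n xs
  proof -
    have "rel A r xs = rel A r (map h xs)"
      using assms(2) that unfolding aut_iff_preserves by blast
    also have "\<dots> = rel A r (map g (map h xs))"
      using assms(1) that(1) map_tuples_permutes[OF that(2) gh(2)] unfolding aut_iff_preserves by blast
    finally show ?thesis by simp
  qed
  ultimately show ?thesis
    unfolding aut_iff_preserves using permutes_compose[OF gh(2,1)] by blast
qed

lemma aut_inv:
  assumes "g \<in> aut L A"
  shows "inv g \<in> aut L A"
proof -
  have g: "g permutes universe A" using assms aut_permutes by auto
  note gi = permutes_inv[OF g]
  have gg: "map g (map (inv g) xs) = xs" for xs
    using permutes_inverses(1)[OF g] by (simp add: map_idI)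
  have "inv g (func A f xs) = func A f (map (inv g) xs)"
    if "fun_arity L f = Some n" "xs \<in> tuples (universe A) n" for f n xs
  proof -
    have "g (func A f (map (inv g) xs)) = func A f xs"
      using assms that(1) map_tuples_permutes[OF that(2) gi] gg unfolding aut_iff_preserves by metis
    then show ?thesis using permutes_inverses(2)[OF g] by metis
  qed
  moreover have "rel A r xs = rel A r (map (inv g) xs)"
    if "rel_arity L r = Some n" "xs \<in> tuples (universe A) n" for r n xs
    using assms that(1) map_tuples_permutes[OF that(2) gi] gg unfolding aut_iff_preserves by metis
  ultimately show ?thesis
    unfolding aut_iff_preserves using gi by blast
qed

lemma map_arrangements_permutes:
  "xs \<in> arrangements n U \<Longrightarrow> g permutes U \<Longrightarrow> map g xs \<in> arrangements n U"
  by (rule map_arrangements) (auto simp: permutes_inj_on permutes_in_image)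

lemma arrangements_tuples: "arrangements n U = {xs \<in> tuples U n. distinct xs}"
  by (auto simp: arrangements_def tuples_def)

section \<open>Alternation, homogeneity and extension in the Fraisse limit\<close>

locale generic_k_orientation =
  fixes k :: nat and M :: "(unit, unit, 'a) fo_struct"
  assumes k_ge_2: "k \<ge> 2" and generic: "generic_orientation k M"
begin

abbreviation "U \<equiv> universe M"
abbreviation "R \<equiv> rel M ()"
abbreviation "L \<equiv> orientation_language k"

lemma countable_U: "countable U"
  and homogeneous: "ultrahomogeneous L M"
  and age_M: "age L M = {A. finite (universe A) \<and> orientation k A}"
  using generic by (auto simp: generic_orientation_def fraisse_limit_def)

lemma embeds:
  fixes A :: "(unit, unit, nat) fo_struct"
  assumes "finite (universe A)" "orientation k A"
  obtains h where "embedding L A M h"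
proof -
  have "A \<in> age L M" using assms by (simp add: age_M)
  then show thesis using that by (auto simp: age_def)
qed

lemma finite_enumeration:
  assumes "finite X"
  obtains e where "bij_betw e {0..<card X} X"
  using ex_bij_betw_nat_finite[OF assms] by blast

text \<open>Members of the age live on natural numbers, so the induced structure on \<open>X\<close>
  is copied along an enumeration \<open>e\<close>. The copy is an orientation, and its properties
  are pulled back along the inverse of \<open>e\<close>.\<close>

lemma orientation_finite_subset:
  assumes "finite X" "X \<subseteq> U"
  shows "\<forall>xs \<in> tuples X k. R xs \<longrightarrow> distinct xs" and "alternating k X R"
proof -
  obtain e where e: "bij_betw e {0..<card X} X" using finite_enumeration assms(1) by blast
  define A :: "(unit, unit, nat) fo_struct" where
    "A = \<lparr>universe = {0..<card X}, func = undefined, rel = \<lambda>_ xs. R (map e xs)\<rparr>"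
  have "embedding L A M e"
    using e assms(2) by (auto simp: embedding_orientation_language A_def bij_betw_def)
  then have "A \<in> age L M"
    by (auto simp: age_def is_structure_orientation_language A_def intro!: finitely_generated_finite)
  then have A: "\<forall>xs \<in> tuples {0..<card X} k. R (map e xs) \<longrightarrow> distinct xs"
    "alternating k {0..<card X} (\<lambda>xs. R (map e xs))"
    unfolding age_M using k_ge_2 by (auto simp: orientation_iff_alternating A_def)
  define r where "r = inv_into {0..<card X} e"
  have r: "bij_betw r X {0..<card X}" and er: "\<And>x. x \<in> X \<Longrightarrow> e (r x) = x"
    using e unfolding r_def by (simp_all add: bij_betw_inv_into bij_betw_inv_into_right)
  then have inv: "map e (map r xs) = xs" if "set xs \<subseteq> X" for xs
    using that by (auto intro!: map_idI)
  have "distinct xs" if "xs \<in> tuples X k" "R xs" for xs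
  proof -
    have "map r xs \<in> tuples {0..<card X} k" using that(1) r by (auto intro!: map_tuples simp: bij_betw_def)
    then have "distinct (map r xs)" using A(1) that inv by (auto simp: tuples_def simp del: map_map)
    then show ?thesis by (simp add: distinct_map)
  qed
  then show "\<forall>xs \<in> tuples X k. R xs \<longrightarrow> distinct xs" by blast
  have "alternating k X (\<lambda>xs. R (map e (map r xs)))"
    by (rule alternating_map[OF A(2)]) (use r in \<open>auto simp: bij_betw_def\<close>)
  then show "alternating k X R"
    by (rule alternating_cong) (simp only: inv arrangements_def mem_Collect_eq)
qed

lemma R_distinct: "xs \<in> tuples U k \<Longrightarrow> R xs \<Longrightarrow> distinct xs"
  using orientation_finite_subset(1)[of "set xs"] by (auto simp: tuples_def)

lemma R_alternating: "alternating k U R"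
proof (rule alternatingI)
  fix us a b vs assume *: "us @ a # b # vs \<in> arrangements k U"
  let ?X = "set (us @ a # b # vs)"
  have "alternating k ?X R" using * by (intro orientation_finite_subset) (auto simp: arrangements_def)
  moreover have "us @ a # b # vs \<in> arrangements k ?X" using * by (auto simp: arrangements_def)
  ultimately have "R (us @ b # a # vs) = (\<not> R (us @ a # b # vs))" by (rule alternatingD)
  then show "R (us @ b # a # vs) \<noteq> R (us @ a # b # vs)" by blast
qed

text \<open>Tuples with a repetition impose no condition: \<open>R\<close> fails on them and on
  their images.\<close>

lemma aut_iff:
  "g \<in> aut L M \<longleftrightarrow> g permutes U \<and> (\<forall>xs \<in> arrangements k U. R (map g xs) = R xs)"
proof -
  have "(\<forall>xs \<in> tuples U k. R xs = R (map g xs)) \<longleftrightarrow> (\<forall>xs \<in> arrangements k U. R (map g xs) = R xs)"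
    if g: "g permutes U"
  proof (rule iffI; rule ballI)
    fix xs assume *: "\<forall>xs \<in> arrangements k U. R (map g xs) = R xs" and xs: "xs \<in> tuples U k"
    show "R xs = R (map g xs)"
    proof (cases "distinct xs")
      case True
      then show ?thesis using * xs by (simp add: arrangements_tuples)
    next
      case False
      then have "\<not> distinct (map g xs)" by (simp add: distinct_map)
      moreover have "map g xs \<in> tuples U k" using xs permutes_image[OF g] by (intro map_tuples) auto
      ultimately show ?thesis using R_distinct xs False by blast
    qed
  qed (auto simp: arrangements_tuples)
  then show ?thesis by (auto simp: aut_orientation_language)
qed

text \<open>Without function symbols every finite set of points is the universe of a finitely
  generated substructure, so ultrahomogeneity applies to maps between finite sets.\<close>

lemma homogeneity:
  assumes X: "finite X" "X \<subseteq> U" and h: "inj_on h X" "h ` X \<subseteq> U"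
    and R: "\<And>xs. xs \<in> arrangements k X \<Longrightarrow> R (map h xs) = R xs"
  obtains g where "g \<in> aut L M" "\<And>x. x \<in> X \<Longrightarrow> g x = h x"
proof -
  define A where "A = M\<lparr>universe := X\<rparr>"
  define B where "B = M\<lparr>universe := h ` X\<rparr>"
  have u: "universe A = X" "universe B = h ` X" "rel A = rel M" "rel B = rel M"
    by (simp_all add: A_def B_def)
  have "R xs = R (map h xs)" if xs: "xs \<in> tuples X k" for xs
  proof (cases "distinct xs")
    case True
    then show ?thesis using R xs by (simp add: arrangements_tuples)
  next
    case False
    then have "\<not> distinct (map h xs)" by (simp add: distinct_map)
    moreover have "map h xs \<in> tuples U k" "xs \<in> tuples U k"
      using xs h X(2) map_tuples[OF xs, of h U] by (auto simp: tuples_def)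
    ultimately show ?thesis using R_distinct False by blast
  qed
  then have "isomorphism L A B h"
    using h by (simp add: isomorphism_def embedding_orientation_language u)
  moreover have "substructure L A M" "substructure L B M"
    using X h by (auto simp: substructure_def embedding_orientation_language u
        is_structure_orientation_language)
  moreover have "finitely_generated L A" "finitely_generated L B"
    using X by (auto intro!: finitely_generated_finite simp: u)
  ultimately obtain g where "g \<in> aut L M" "\<forall>x \<in> universe A. g x = h x"
    using homogeneous unfolding ultrahomogeneous_def by metis
  then show thesis using that u by simp
qed

lemma homogeneity_maps:
  assumes N: "finite N" and h: "inj_on h N" "h ` N \<subseteq> U" and e: "inj_on e N" "e ` N \<subseteq> U"
    and he: "\<And>zs. zs \<in> arrangements k N \<Longrightarrow> R (map e zs) = R (map h zs)"
  obtains g where "g \<in> aut L M" "\<And>i. i \<in> N \<Longrightarrow> g (h i) = e i"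
proof -
  define r where "r = inv_into N h"
  have r: "r (h i) = i" if "i \<in> N" for i using that h(1) by (simp add: r_def)
  have "R (map (e \<circ> r) xs) = R xs" if xs: "xs \<in> arrangements k (h ` N)" for xs
  proof -
    have hr: "map h (map r xs) = xs"
      using xs r by (auto simp: arrangements_def intro!: map_idI)
    have "map r xs \<in> arrangements k N"
      using xs by (rule map_arrangements) (auto simp: r inj_on_def)
    from he[OF this] hr show ?thesis by (metis map_map)
  qed
  moreover have "inj_on (e \<circ> r) (h ` N)" "(e \<circ> r) ` h ` N \<subseteq> U"
    using e by (auto simp: inj_on_def r)
  moreover have "finite (h ` N)" using N by simp
  ultimately obtain g where "g \<in> aut L M" "\<And>x. x \<in> h ` N \<Longrightarrow> g x = (e \<circ> r) x"
    using homogeneity[of "h ` N" "e \<circ> r"] h(2) by metis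
  then show thesis using r that by simp
qed

text \<open>Add to a copy \<open>N\<close> of \<open>X\<close> one vertex \<open>m\<close> with link
  \<phi>. This finite orientation embeds into \<open>M\<close>, homogeneity moves the image of
  \<open>N\<close> onto \<open>X\<close>, and \<open>b\<close> is where the image of
  \<open>m\<close> ends up.\<close>

lemma extension:
  assumes X: "finite X" "X \<subseteq> U" and \<phi>: "alternating (k - 1) X \<phi>"
  obtains b where "b \<in> U - X" "\<And>ys. ys \<in> arrangements (k - 1) X \<Longrightarrow> R (b # ys) = \<phi> ys"
proof -
  obtain n where k: "k = Suc n" using k_ge_2 by (cases k) auto
  define m where "m = card X"
  define N where "N = {0..<m}"
  obtain e where e: "bij_betw e N X" using finite_enumeration X(1) unfolding N_def m_def by blast
  define f where "f xs = (if m \<in> set xs then insertion m (\<lambda>ys. \<phi> (map e ys)) xs else R (map e xs))" for xs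
  define A :: "(unit, unit, nat) fo_struct" where
    "A = \<lparr>universe = insert m N, func = undefined, rel = \<lambda>_ xs. distinct xs \<and> f xs\<rparr>"
  have "alternating k (insert m N) f"
    unfolding f_def k
  proof (rule alternating_insertion)
    show "alternating n N (\<lambda>ys. \<phi> (map e ys))"
      using \<phi> e by (intro alternating_map[of n X]) (auto simp: k bij_betw_def)
    show "alternating (Suc n) N (\<lambda>ys. R (map e ys))"
      using R_alternating X(2) e by (intro alternating_map[of "Suc n" U]) (auto simp: k bij_betw_def)
  qed (simp add: N_def)
  then have "alternating k (insert m N) (rel A ())"
    by (rule alternating_cong) (auto simp: A_def arrangements_def)
  then have "orientation k A" using k_ge_2 by (auto simp: orientation_iff_alternating A_def)
  then obtain h where "embedding L A M h"
    using embeds[of A] by (auto simp: A_def N_def)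
  then have h: "h ` insert m N \<subseteq> U" "inj_on h (insert m N)"
    "\<And>xs. xs \<in> arrangements k (insert m N) \<Longrightarrow> R (map h xs) = f xs"
    by (auto simp: embedding_orientation_language A_def arrangements_tuples)
  have mN: "m \<notin> N" by (simp add: N_def)
  have hN: "inj_on h N" "h ` N \<subseteq> U" using h by (auto simp: inj_on_insert)
  have eN: "inj_on e N" "e ` N \<subseteq> U" using e X(2) by (auto simp: bij_betw_def)
  have "R (map e zs) = R (map h zs)" if zs: "zs \<in> arrangements k N" for zs
  proof -
    have "m \<notin> set zs" using zs mN by (auto simp: arrangements_def)
    then have "f zs = R (map e zs)" by (simp add: f_def)
    then show ?thesis using h(3)[OF subsetD[OF arrangements_mono[OF subset_insertI] zs]] by simp
  qed
  then obtain g where g: "g \<in> aut L M" and ge: "\<And>i. i \<in> N \<Longrightarrow> g (h i) = e i"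
    using homogeneity_maps[OF _ hN eN] by (auto simp: N_def)
  have gp: "g permutes U" using g by (rule aut_permutes)
  show thesis
  proof (rule that[of "g (h m)"])
    have "g (h m) \<in> U" using h(1) gp by (simp add: permutes_in_image)
    moreover have "g (h m) \<notin> X"
    proof
      assume "g (h m) \<in> X"
      then obtain i where i: "i \<in> N" "g (h m) = e i" using e by (auto simp: bij_betw_def)
      then have "h m = h i" using ge permutes_inj[OF gp] by (metis injD)
      then show False using h(2) i(1) mN by (auto simp: inj_on_def)
    qed
    ultimately show "g (h m) \<in> U - X" by blast
    fix ys assume ys: "ys \<in> arrangements (k - 1) X"
    define zs where "zs = map (inv_into N e) ys"
    have zs: "zs \<in> arrangements n N" unfolding zs_def
      using ys bij_betw_inv_into[OF e] by (intro map_arrangements[of _ _ X]) (auto simp: k bij_betw_def)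
    have ez: "map e zs = ys" unfolding zs_def
      using ys bij_betw_inv_into_right[OF e] by (auto simp: arrangements_def intro!: map_idI)
    have "map g (map h zs) = map e zs" using zs ge by (auto simp: arrangements_def)
    then have "g (h m) # ys = map g (map h (m # zs))" using ez by simp
    moreover have mzs: "m # zs \<in> arrangements k (insert m N)" using zs mN by (simp add: k)
    moreover have "map h (m # zs) \<in> arrangements k U"
      using map_arrangements[OF mzs h(2,1)] .
    ultimately have "R (g (h m) # ys) = R (map h (m # zs))" using g unfolding aut_iff by metis
    also have "\<dots> = f (m # zs)" using h(3)[OF mzs] .
    also have "\<dots> = \<phi> ys" using ez by (simp add: f_def)
    finally show "R (g (h m) # ys) = \<phi> ys" .
  qed
qed

end

section \<open>Transitive extensions force even arity\<close>

text \<open>By injectivity no old point is sent to \<open>None\<close>, so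
  \<open>restrict_old\<close> never evaluates \<open>the None\<close>.\<close>

lemma aut_fixing_None:
  assumes g: "g permutes insert None (Some ` A)" "g None = None"
  shows "g (Some x) = Some (restrict_old g x)" and "restrict_old g permutes A"
proof -
  have Some: "g (Some x) = Some (restrict_old g x)" for x
    using permutes_inj[OF g(1)] g(2) unfolding restrict_old_def by (metis injD option.distinct(1) option.exhaust_sel)
  then show "g (Some x) = Some (restrict_old g x)" .
  show "restrict_old g permutes A"
  proof (rule bij_imp_permutes)
    show "bij_betw (restrict_old g) A A"
    proof (rule bij_betwI')
      show "(restrict_old g x = restrict_old g y) = (x = y)" for x y
        using Some permutes_inj[OF g(1)] by (metis injD option.inject)
      show "restrict_old g x \<in> A" if "x \<in> A" for x
        using that Some[of x] permutes_in_image[OF g(1), of "Some x"] by auto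
      show "\<exists>x\<in>A. y = restrict_old g x" if y: "y \<in> A" for y
      proof -
        obtain z where z: "g z = Some y" using permutes_surj[OF g(1)] by (metis surjD)
        then obtain x where x: "z = Some x" using g(2) by (cases z) auto
        then have "x \<in> A" using permutes_in_image[OF g(1), of z] z y by auto
        then show ?thesis using Some[of x] x z by auto
      qed
    qed
    show "restrict_old g x = x" if "x \<notin> A" for x
    proof -
      have "Some x \<notin> insert None (Some ` A)" using that by auto
      from permutes_not_in[OF g(1) this] show ?thesis by (simp add: restrict_old_def)
    qed
  qed
qed

lemma map_Some_arrangements:
  "map Some xs \<in> arrangements n (insert None (Some ` A)) \<longleftrightarrow> xs \<in> arrangements n A"
  by (auto simp: arrangements_def distinct_map)

text \<open>\<open>True\<close> means an even number of inversions. On repetition-free lists this is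
  the orientation induced by the order of the natural numbers.\<close>

fun inversion_sign :: "nat list \<Rightarrow> bool" where
  "inversion_sign [] = True"
| "inversion_sign (x # xs) = (inversion_sign xs \<noteq> odd (length (filter (\<lambda>y. y < x) xs)))"

lemma alternating_inversion_sign: "alternating n N inversion_sign"
proof (rule alternatingI)
  fix us a b vs assume "us @ a # b # vs \<in> arrangements n N"
  then have "a \<noteq> b" by (auto simp: arrangements_def)
  then show "inversion_sign (us @ b # a # vs) \<noteq> inversion_sign (us @ a # b # vs)"
    by (induction us) auto
qed

lemma inversion_sign_map_Suc: "inversion_sign (map Suc xs) = inversion_sign xs"
  by (induction xs) (simp_all add: filter_map comp_def)

text \<open>The shift preserves the order except that it sends the maximum \<open>k\<close> to the
  minimum \<open>0\<close>. At the front of a list, \<open>k\<close> forms an inversion with each of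
  the other \<open>k - 1\<close> entries, an even number, and \<open>0\<close> forms none.\<close>

lemma inversion_sign_rotate:
  assumes "odd k" and xs: "xs \<in> arrangements k {0..<Suc k}"
  shows "inversion_sign (map (\<lambda>i. if i = k then 0 else Suc i) xs) = inversion_sign xs"
proof (cases "k \<in> set xs")
  case False
  then have "map (\<lambda>i. if i = k then 0 else Suc i) xs = map Suc xs" by auto
  then show ?thesis by (simp only: inversion_sign_map_Suc)
next
  case True
  then obtain us vs where uv: "xs = us @ k # vs" by (meson split_list)
  have map: "map (\<lambda>i. if i = k then 0 else Suc i) xs = map Suc us @ 0 # map Suc vs"
    using xs uv by (auto simp: arrangements_def)
  have "filter (\<lambda>y. y < k) (us @ vs) = us @ vs"
  proof (rule filter_True, rule ballI)
    fix i assume "i \<in> set (us @ vs)"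
    then have "i \<in> {0..<Suc k}" "i \<noteq> k" using xs uv by (auto simp: arrangements_def)
    then show "i < k" by simp
  qed
  then have k: "inversion_sign (k # us @ vs) = inversion_sign (us @ vs)"
    using xs uv \<open>odd k\<close> by (auto simp: arrangements_def)
  have z: "inversion_sign (0 # map Suc us @ map Suc vs) = inversion_sign (us @ vs)"
    using inversion_sign_map_Suc[of "us @ vs"] by simp
  have "us @ k # vs \<in> arrangements k UNIV" using xs uv by (simp add: arrangements_def)
  from alternating_move[OF alternating_inversion_sign this]
  have "inversion_sign (us @ k # vs) = (inversion_sign (us @ vs) \<noteq> odd (length us))"
    using k by simp
  moreover have "map Suc us @ 0 # map Suc vs \<in> arrangements k UNIV"
    using xs uv by (auto simp: arrangements_def distinct_map)
  from alternating_move[OF alternating_inversion_sign this]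
  have "inversion_sign (map Suc us @ 0 # map Suc vs) = (inversion_sign (us @ vs) \<noteq> odd (length us))"
    using z by simp
  ultimately show ?thesis unfolding map by (simp only: uv)
qed

section \<open>The invariant sign of a transitive extension\<close>

locale transitive_extension_generic = generic_k_orientation +
  fixes L' :: "('g, 's) language" and M' :: "('g, 's, 'a option) fo_struct"
  assumes transitive_extension: "transitive_extension (orientation_language k) M L' M'"
begin

abbreviation "V \<equiv> insert None (Some ` U)"
abbreviation "G \<equiv> aut L' M'"

lemma G_permutes: "g \<in> G \<Longrightarrow> g permutes V"
  using transitive_extension aut_permutes[of g L' M']
  by (simp add: transitive_extension_def one_point_extension_def)

lemma G_transitive: "y \<in> V \<Longrightarrow> \<exists>g \<in> G. g y = None"
  using transitive_extension
  by (simp add: transitive_extension_def one_point_extension_def)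

lemma stabilizer: "restrict_old ` {g \<in> G. g None = None} = aut L M"
  using transitive_extension
  by (simp add: transitive_extension_def one_point_extension_def)

lemma lift_aut:
  assumes "f \<in> aut L M"
  obtains F where "F \<in> G" "F None = None" "restrict_old F = f"
proof -
  have "f \<in> restrict_old ` {g \<in> G. g None = None}" unfolding stabilizer by (rule assms)
  then show thesis using that by auto
qed

lemma map_the_G:
  assumes "y # ys \<in> arrangements (Suc k) V" "g \<in> G" "g y = None"
  shows "map Some (map (\<lambda>z. the (g z)) ys) = map g ys"
    and "map (\<lambda>z. the (g z)) ys \<in> arrangements k U"
proof -
  note g = G_permutes[OF assms(2)]
  have "y \<notin> set ys" using assms(1) by (auto simp: arrangements_def)
  then have "g z \<noteq> None" if "z \<in> set ys" for z
    using that assms(3) permutes_inj[OF g] by (metis injD)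
  then show eq: "map Some (map (\<lambda>z. the (g z)) ys) = map g ys" by auto
  have "map g ys \<in> arrangements k V"
    using assms(1) by (intro map_arrangements_permutes[OF _ g]) (auto simp: arrangements_def)
  then have "map Some (map (\<lambda>z. the (g z)) ys) \<in> arrangements k V" by (simp only: eq)
  then show "map (\<lambda>z. the (g z)) ys \<in> arrangements k U"
    unfolding map_Some_arrangements .
qed

text \<open>Independent of the choice of \<open>g\<close>, because the stabilizer of \<^const>\<open>None\<close> preserves \<open>R\<close>.\<close>

definition S :: "'a option list \<Rightarrow> bool" where
  "S ys \<longleftrightarrow> (\<exists>g \<in> G. g (hd ys) = None \<and> R (map (\<lambda>z. the (g z)) (tl ys)))"

text \<open>Two choices \<open>g\<close> and \<open>g'\<close> differ by
  \<open>g \<circ> inv g'\<close>, which fixes \<open>None\<close> and hence restricts to an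
  automorphism of \<open>M\<close>.\<close>

lemma S_eq:
  assumes ys: "y # ys \<in> arrangements (Suc k) V" and g: "g \<in> G" "g y = None"
  shows "S (y # ys) = R (map (\<lambda>z. the (g z)) ys)"
proof -
  have "R (map (\<lambda>z. the (g z)) ys)" if g': "g' \<in> G" "g' y = None" "R (map (\<lambda>z. the (g' z)) ys)" for g'
  proof -
    define f where "f = g \<circ> inv g'"
    note g'p = G_permutes[OF g'(1)]
    have f: "f \<in> G" unfolding f_def by (intro aut_comp aut_inv g g')
    have fg': "f (g' z) = g z" for z using permutes_inverses(2)[OF g'p] by (simp add: f_def)
    then have fN: "f None = None" using g g' by metis
    then have h: "restrict_old f \<in> aut L M" using f stabilizer by blast
    have "map Some (map (\<lambda>z. the (g z)) ys) = map f (map g' ys)"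
      using map_the_G(1)[OF ys g] fg' by simp
    also have "\<dots> = map f (map Some (map (\<lambda>z. the (g' z)) ys))"
      using map_the_G(1)[OF ys g'(1,2)] by simp
    also have "\<dots> = map Some (map (restrict_old f) (map (\<lambda>z. the (g' z)) ys))"
      using aut_fixing_None(1)[OF G_permutes[OF f] fN] by simp
    finally have "map (\<lambda>z. the (g z)) ys = map (restrict_old f) (map (\<lambda>z. the (g' z)) ys)"
      by (metis list.inj_map_strong option.inject)
    then show ?thesis using h g'(3) map_the_G(2)[OF ys g'(1,2)] unfolding aut_iff by metis
  qed
  then show ?thesis using g unfolding S_def by auto
qed

text \<open>If \<open>f\<close> moves the head of \<open>map g ys\<close> to \<open>None\<close>,
  then \<open>f \<circ> g\<close> does so for \<open>ys\<close>, and both signs are read off the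
  same tuple.\<close>

lemma S_invariant:
  assumes "g \<in> G" "ys \<in> arrangements (Suc k) V"
  shows "S (map g ys) = S ys"
proof -
  obtain y zs where ys: "ys = y # zs" using assms(2) by (cases ys) (auto simp: arrangements_def)
  have gys: "map g ys \<in> arrangements (Suc k) V"
    using map_arrangements_permutes[OF assms(2) G_permutes[OF assms(1)]] .
  then have "g y \<in> V" by (simp add: ys)
  then obtain f where f: "f \<in> G" "f (g y) = None" using G_transitive by blast
  then have "f \<circ> g \<in> G" "(f \<circ> g) y = None" using assms(1) aut_comp by auto
  then have "S ys = R (map (\<lambda>z. the ((f \<circ> g) z)) zs)"
    using S_eq assms(2) unfolding ys by blast
  moreover have "S (map g ys) = R (map (\<lambda>z. the (f z)) (map g zs))"
    using S_eq[OF _ f] gys unfolding ys by simp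
  ultimately show ?thesis by (simp add: comp_def)
qed

lemma S_alternates_tail:
  assumes "u # us @ a # b # vs \<in> arrangements (Suc k) V"
  shows "S (u # us @ b # a # vs) = (\<not> S (u # us @ a # b # vs))"
proof -
  have "u \<in> V" using assms by simp
  then obtain g where g: "g \<in> G" "g u = None" using G_transitive by blast
  have "u # us @ b # a # vs \<in> arrangements (Suc k) V" using assms by (auto simp: arrangements_def)
  then show ?thesis
    using S_eq[OF _ g] assms map_the_G(2)[OF assms g] alternatingD[OF R_alternating] by simp
qed

text \<open>Moving both heads to \<open>None\<close> leaves two \<open>k\<close>-tuples with equal
  \<open>R\<close>. Homogeneity takes one to the other, and this automorphism of \<open>M\<close>
  lifts to the stabilizer of \<open>None\<close>.\<close>

lemma S_two_orbits:
  assumes ys: "ys \<in> arrangements (Suc k) V" and zs: "zs \<in> arrangements (Suc k) V"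
    and eq: "S ys = S zs"
  obtains g where "g \<in> G" "map g ys = zs"
proof -
  obtain y ys' where y: "ys = y # ys'" using ys by (cases ys) (auto simp: arrangements_def)
  obtain z zs' where z: "zs = z # zs'" using zs by (cases zs) (auto simp: arrangements_def)
  obtain g1 where g1: "g1 \<in> G" "g1 y = None" using G_transitive ys y by auto
  obtain g2 where g2: "g2 \<in> G" "g2 z = None" using G_transitive zs z by auto
  define p where "p = map (\<lambda>x. the (g1 x)) ys'"
  define q where "q = map (\<lambda>x. the (g2 x)) zs'"
  have p: "p \<in> arrangements k U" "map Some p = map g1 ys'"
    using map_the_G[OF _ g1] ys unfolding p_def y by auto
  have q: "q \<in> arrangements k U" "map Some q = map g2 zs'"
    using map_the_G[OF _ g2] zs unfolding q_def z by auto
  have pq: "R p = R q" using eq ys zs S_eq[OF _ g1] S_eq[OF _ g2] unfolding p_def q_def y z by simp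
  define N where "N = {0..<k}"
  have inj: "inj_on ((!) r) N" "(!) r ` N \<subseteq> U" if "r \<in> arrangements k U" for r
    using that by (auto simp: N_def arrangements_def inj_on_nth intro!: nth_mem[THEN subsetD[rotated]])
  \<comment> \<open>The tuples are read as maps on indices. Equality at \<open>[0..<k]\<close> gives
    equality at every reordering by \<open>alternating_agree\<close>.\<close>
  have "R (map ((!) q) xs) = R (map ((!) p) xs)" if xs: "xs \<in> arrangements k N" for xs
  proof (rule alternating_agree[of k N _ _ "[0..<k]"])
    show "alternating k N (\<lambda>xs. R (map ((!) q) xs))" "alternating k N (\<lambda>xs. R (map ((!) p) xs))"
      using alternating_map[OF R_alternating inj] p(1) q(1) by auto
    show "[0..<k] \<in> arrangements k N" by (auto simp: arrangements_def N_def)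
    show "set [0..<k] = set xs" using arrangements_full[OF xs] by (auto simp: N_def)
    have "length p = k" "length q = k" using p(1) q(1) by (auto simp: arrangements_def)
    then have "map ((!) p) [0..<k] = p" "map ((!) q) [0..<k] = q" using map_nth by metis+
    then show "R (map ((!) q) [0..<k]) = R (map ((!) p) [0..<k])" using pq by simp
  qed (rule xs)
  then obtain f where f: "f \<in> aut L M" "\<And>i. i \<in> N \<Longrightarrow> f (p ! i) = q ! i"
    using homogeneity_maps[OF _ inj[OF p(1)] inj[OF q(1)]] by (auto simp: N_def)
  then have fpq: "map f p = q"
    using p(1) q(1) by (intro nth_equalityI) (auto simp: arrangements_def N_def)
  obtain F where F: "F \<in> G" "F None = None" "restrict_old F = f" using lift_aut[OF f(1)] .
  show thesis
  proof (rule that[of "inv g2 \<circ> F \<circ> g1"])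
    show "inv g2 \<circ> F \<circ> g1 \<in> G" by (intro aut_comp aut_inv g1 g2 F)
    note g2i = permutes_inverses(2)[OF G_permutes[OF g2(1)]]
    have "map F (map Some p) = map Some q"
      using aut_fixing_None(1)[OF G_permutes[OF F(1)] F(2)] F(3) fpq[symmetric] by simp
    then have "map (inv g2) (map F (map g1 ys')) = map (inv g2) (map g2 zs')"
      by (simp only: p q)
    also have "\<dots> = zs'" using g2i by (simp add: map_idI)
    finally have "map (inv g2 \<circ> F \<circ> g1) ys' = zs'" by (simp add: comp_assoc)
    moreover have "inv g2 (F (g1 y)) = z" using g1(2) F(2) g2i[of z] g2(2) by simp
    ultimately show "map (inv g2 \<circ> F \<circ> g1) ys = zs" by (simp add: y z)
  qed
qed

lemma S_swap_head_cong:
  assumes "a # b # us \<in> arrangements (Suc k) V" "c # d # vs \<in> arrangements (Suc k) V"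
    and eq: "S (a # b # us) = S (c # d # vs)"
  shows "S (b # a # us) = S (d # c # vs)"
proof -
  obtain g where g: "g \<in> G" "map g (a # b # us) = c # d # vs" using S_two_orbits[OF assms] .
  have "b # a # us \<in> arrangements (Suc k) V" using assms(1) by (auto simp: arrangements_def)
  from S_invariant[OF g(1) this] g(2) show ?thesis by simp
qed

text \<open>By \<open>S_swap_head_cong\<close> the head swap induces an involution of the two signs,
  the same for all lists. If it fixes one sign, it fixes the other as well.\<close>

lemma S_swap_head_uniform:
  assumes "a # b # us \<in> arrangements (Suc k) V" "c # d # vs \<in> arrangements (Suc k) V"
    and eq: "S (b # a # us) = S (a # b # us)"
  shows "S (d # c # vs) = S (c # d # vs)"
proof -
  have dc: "d # c # vs \<in> arrangements (Suc k) V" using assms(2) by (auto simp: arrangements_def)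
  show ?thesis
    using S_swap_head_cong[OF assms(1,2)] S_swap_head_cong[OF assms(1) dc] eq by blast
qed

lemma S_alternating: "alternating (Suc k) V S"
proof (rule alternatingI)
  fix us a b vs assume *: "us @ a # b # vs \<in> arrangements (Suc k) V"
  show "S (us @ b # a # vs) \<noteq> S (us @ a # b # vs)"
  proof (cases us)
    case (Cons u ws)
    then show ?thesis using S_alternates_tail[of u ws a b vs] * by simp
  next
    case Nil
    have ab: "a # b # vs \<in> arrangements (Suc k) V" using * Nil by simp
    then obtain c ws where vs: "vs = c # ws"
      using k_ge_2 by (cases vs) (auto simp: arrangements_def)
    have arr: "xs \<in> arrangements (Suc k) V" if "mset xs = mset (a # b # c # ws)" for xs
      using ab that unfolding vs arrangements_def mem_Collect_eq
      by (metis mset_eq_imp_distinct_iff mset_eq_length mset_eq_setD)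
    show ?thesis
    proof
      assume "S (us @ b # a # vs) = S (us @ a # b # vs)"
      then have eq: "S (b # a # vs) = S (a # b # vs)" using Nil by simp
      note swap = S_swap_head_uniform[OF ab _ eq]
      have t: "S (x # z # y # ws) = (\<not> S (x # y # z # ws))"
        if "mset (x # y # z # ws) = mset (a # b # c # ws)" for x y z
        using S_alternates_tail[of x "[]" y z ws] arr[OF that] by simp
      \<comment> \<open>The six orderings of \<open>a\<close>, \<open>b\<close>, \<open>c\<close>
        form a hexagon whose edges are alternately head swaps, which by assumption preserve
        \<open>S\<close>, and tail swaps, which flip it. Three flips in one circuit are
        impossible.\<close>
      have "S (b # a # c # ws) = S (a # b # c # ws)" "S (c # b # a # ws) = S (b # c # a # ws)"
        "S (c # a # b # ws) = S (a # c # b # ws)"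
        by (rule swap; rule arr; simp)+
      moreover have "S (b # c # a # ws) = (\<not> S (b # a # c # ws))"
        "S (a # c # b # ws) = (\<not> S (a # b # c # ws))" "S (c # b # a # ws) = (\<not> S (c # a # b # ws))"
        by (rule t; simp)+
      ultimately show False by blast
    qed
  qed
qed

lemma even_k: "even k"
proof (rule ccontr)
  assume odd: "odd k"
  define N where "N = {0..<Suc k}"
  define A :: "(unit, unit, nat) fo_struct" where
    "A = \<lparr>universe = N, func = undefined, rel = \<lambda>_ xs. distinct xs \<and> inversion_sign xs\<rparr>"
  have "alternating k N (rel A ())"
    using alternating_inversion_sign by (rule alternating_cong) (auto simp: A_def arrangements_def)
  then have "orientation k A" using k_ge_2 by (auto simp: orientation_iff_alternating A_def)
  then obtain h where "embedding L A M h" using embeds[of A] by (auto simp: A_def N_def)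
  then have h: "h ` N \<subseteq> U" "inj_on h N"
    "\<And>xs. xs \<in> arrangements k N \<Longrightarrow> R (map h xs) = inversion_sign xs"
    by (auto simp: embedding_orientation_language A_def arrangements_tuples)
  \<comment> \<open>By \<open>inversion_sign_rotate\<close> this \<open>(k+1)\<close>-cycle
    preserves the orientation, so homogeneity extends it to an automorphism of
    \<open>M\<close>.\<close>
  define c where "c i = (if i = k then 0 else Suc i)" for i
  have c: "c ` N \<subseteq> N" "inj_on c N" by (auto simp: c_def N_def inj_on_def)
  have hc: "R (map (h \<circ> c) zs) = R (map h zs)" if zs: "zs \<in> arrangements k N" for zs
  proof -
    have "map c zs \<in> arrangements k N" using map_arrangements[OF zs c(2,1)] .
    moreover have "inversion_sign (map c zs) = inversion_sign zs"
      using inversion_sign_rotate[OF odd] zs unfolding N_def c_def by blast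
    ultimately show ?thesis using h(3) zs by (metis map_map)
  qed
  have inj_hc: "inj_on (h \<circ> c) N" "(h \<circ> c) ` N \<subseteq> U"
    using c h(1,2) by (auto simp: inj_on_def subset_eq)
  have "finite N" by (simp add: N_def)
  from homogeneity_maps[OF this h(2,1) inj_hc hc]
  obtain g where g: "g \<in> aut L M" "\<And>i. i \<in> N \<Longrightarrow> g (h i) = h (c i)"
    by (metis comp_apply)
  obtain F where F: "F \<in> G" "F None = None" "restrict_old F = g" using lift_aut[OF g(1)] .
  have FS: "F (Some x) = Some (g x)" for x
    using aut_fixing_None(1)[OF G_permutes[OF F(1)] F(2)] F(3) by simp
  define w where "w = map (\<lambda>i. Some (h i)) [1..<Suc k]"
  have zero: "[0..<Suc k] = 0 # [1..<Suc k]" by (simp add: upt_conv_Cons)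
  have "(Some (h 0)) # w = map (\<lambda>i. Some (h i)) [0..<Suc k]" unfolding w_def zero by simp
  also have "\<dots> \<in> arrangements (Suc k) V"
  proof (rule map_arrangements)
    show "[0..<Suc k] \<in> arrangements (Suc k) N" by (auto simp: arrangements_def N_def)
  qed (use h(1,2) in \<open>auto simp: inj_on_def\<close>)
  finally have arr: "Some (h 0) # w \<in> arrangements (Suc k) V" .
  have Suc: "map Suc [0..<k] = [1..<Suc k]" by (simp add: map_Suc_upt)
  have "map F (Some (h 0) # w) = map F (map (\<lambda>i. Some (h i)) [0..<Suc k])"
    unfolding w_def zero by simp
  also have "\<dots> = map (\<lambda>i. Some (h (c i))) ([0..<k] @ [k])"
    using FS g(2) by (auto simp: N_def)
  also have "\<dots> = map (\<lambda>i. Some (h i)) (map Suc [0..<k]) @ [Some (h 0)]"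
    by (auto simp: c_def)
  also have "\<dots> = w @ [Some (h 0)]" unfolding Suc w_def ..
  finally have Fw: "map F (Some (h 0) # w) = w @ [Some (h 0)]" .
  \<comment> \<open>Returning \<open>Some (h 0)\<close> to the front takes \<open>k\<close> swaps,
    an odd number, whereas \<open>F\<close> leaves \<open>S\<close> unchanged.\<close>
  have "w @ Some (h 0) # [] \<in> arrangements (Suc k) V"
    using arr unfolding arrangements_Cons_move by simp
  from alternating_move[OF S_alternating this]
  have "S (w @ [Some (h 0)]) = (S (Some (h 0) # w) \<noteq> odd (length w))" by simp
  moreover have "length w = k" by (simp add: w_def)
  ultimately show False using odd S_invariant[OF F(1) arr] Fw by simp
qed

end

section \<open>The extension for even arity\<close>

text \<open>For odd \<open>n\<close> the parity is opposite to that in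
  \<open>alternating_delta\<close>: each swap flips \<open>n - 1\<close> terms, an even number, so
  the coboundary is symmetric.\<close>

lemma delta_move:
  assumes "alternating n U f" "odd n" "us @ a # vs \<in> arrangements (Suc n) U"
  shows "delta f (us @ a # vs) = delta f (a # us @ vs)"
  using assms(3)
proof (induction us arbitrary: vs rule: rev_induct)
  case (snoc u us)
  have *: "us @ a # u # vs \<in> arrangements (Suc n) U"
    using snoc.prems by (auto simp: arrangements_def)
  then have "even (length (us @ vs))" using assms(2) by (auto simp: arrangements_def)
  then show ?case using delta_swap[OF assms(1) *] snoc.IH[OF *] by simp
qed simp

lemma without_None:
  assumes "None \<notin> set ys"
  obtains xs where "ys = map Some xs"
proof (rule that)
  have "Some (the y) = y" if "y \<in> set ys" for y using that assms by (metis option.exhaust_sel)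
  then show "ys = map Some (map the ys)" by (simp add: map_idI)
qed

section \<open>The orientation on the extended set and its links\<close>

locale generic_even_orientation = generic_k_orientation +
  assumes even: "even k"
begin

abbreviation "V \<equiv> insert None (Some ` U)"

abbreviation R\<^sub>0 :: "'a option list \<Rightarrow> bool" where
  "R\<^sub>0 ys \<equiv> R (map the ys)"

text \<open>On repetition-free lists \<open>R\<^sub>0\<close> is evaluated only away from
  \<open>None\<close>, so the arbitrary value \<open>the None\<close> does not enter.\<close>

definition S :: "'a option list \<Rightarrow> bool" where
  "S ys = (if None \<in> set ys then insertion None R\<^sub>0 ys else delta R\<^sub>0 ys)"

lemma R0_alternating: "alternating k (Some ` U) R\<^sub>0"
  by (rule alternating_map[OF R_alternating]) (auto simp: inj_on_def)

lemma S_alternating: "alternating (Suc k) V S"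
  unfolding S_def
  by (intro alternating_insertion alternating_delta R0_alternating even) auto

lemma S_None: "S (None # map Some xs) = R xs"
  by (simp add: S_def comp_def)

lemma S_Some: "S (map Some xs) = delta R xs"
  using delta_map[of R the "map Some xs"] by (simp add: S_def comp_def image_iff)

text \<open>Away from \<open>None\<close> this is \<open>delta_delta\<close>. Otherwise
  \<open>delta_move\<close> brings \<open>None\<close> to the front, as \<open>k + 1\<close> is odd;
  deleting \<open>None\<close> contributes the coboundary of \<open>R\<^sub>0\<close> at the
  remaining list, and so do the other terms together.\<close>

lemma delta_S:
  assumes "ys \<in> arrangements (Suc (Suc k)) V"
  shows "\<not> delta S ys"
proof (cases "None \<in> set ys")
  case False
  then have "ys \<in> arrangements (Suc (Suc k)) (Some ` U)" using assms by (auto simp: arrangements_def)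
  then have "delta S ys = delta (delta R\<^sub>0) ys"
    by (rule delta_cong[rotated]) (auto simp: S_def arrangements_def)
  then show ?thesis by (simp add: delta_delta)
next
  case True
  then obtain us vs where ys: "ys = us @ None # vs" by (meson split_list)
  have N: "None # us @ vs \<in> arrangements (Suc (Suc k)) V"
    using assms unfolding ys arrangements_Cons_move .
  then have uv: "us @ vs \<in> arrangements (Suc k) (Some ` U)" by (auto simp: arrangements_def)
  have "delta S ys = delta S (None # us @ vs)"
    unfolding ys using assms even by (intro delta_move[OF S_alternating]) (auto simp: ys)
  moreover have "delta (\<lambda>zs. S (None # zs)) (us @ vs) = delta R\<^sub>0 (us @ vs)"
    using uv by (rule delta_cong[rotated]) (simp add: S_def)
  moreover have "S (us @ vs) = delta R\<^sub>0 (us @ vs)"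
    using uv by (auto simp: S_def arrangements_def)
  ultimately show ?thesis by simp
qed

text \<open>The vanishing coboundary at \<open>a # ys\<close>, solved for \<open>S ys\<close>: the
  link at one point determines \<open>S\<close>.\<close>

lemma S_eq_delta_link:
  assumes "a \<in> V" "ys \<in> arrangements (Suc k) (V - {a})"
  shows "S ys = delta (\<lambda>zs. S (a # zs)) ys"
proof -
  have "a # ys \<in> arrangements (Suc (Suc k)) V" using assms by simp
  from delta_S[OF this] show ?thesis by simp
qed

text \<open>An isomorphism from the link at \<open>None\<close> to the link at \<open>a\<close>
  preserves \<open>S\<close> once \<open>None\<close> is sent to \<open>a\<close>. Off
  \<open>None\<close>, both values are coboundaries of corresponding links; through
  \<open>None\<close>, moving it to the front reduces to the links themselves.\<close>

lemma S_preserved: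
  assumes a: "a \<in> V" and h: "inj_on h U" "h ` U \<subseteq> V - {a}"
    and link: "\<And>xs. xs \<in> arrangements k U \<Longrightarrow> S (a # map h xs) = R xs"
    and H: "H None = a" "\<And>x. x \<in> U \<Longrightarrow> H (Some x) = h x"
    and ys: "ys \<in> arrangements (Suc k) V"
  shows "S (map H ys) = S ys"
proof -
  have Hh: "map H (map Some xs) = map h xs" if "xs \<in> arrangements n U" for xs n
    using that H(2) by (auto simp: arrangements_def)
  show ?thesis
  proof (cases "None \<in> set ys")
    case False
    then obtain xs where xs: "ys = map Some xs" using without_None by blast
    with ys have xsU: "xs \<in> arrangements (Suc k) U" by (simp only: map_Some_arrangements)
    have "S (map H ys) = S (map h xs)" unfolding xs Hh[OF xsU] ..
    also have "\<dots> = delta (\<lambda>zs. S (a # zs)) (map h xs)"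
      by (rule S_eq_delta_link[OF a map_arrangements[OF xsU h]])
    also have "\<dots> = delta (\<lambda>zs. S (a # map h zs)) xs"
      by (rule delta_map[symmetric])
    also have "\<dots> = delta R xs" by (rule delta_cong[OF link xsU])
    also have "\<dots> = S ys" unfolding xs S_Some ..
    finally show ?thesis .
  next
    case True
    then obtain us vs where uv: "ys = us @ None # vs" by (meson split_list)
    have N: "None # us @ vs \<in> arrangements (Suc k) V" using ys unfolding uv arrangements_Cons_move .
    then have "None \<notin> set (us @ vs)" by (auto simp: arrangements_def)
    then obtain xs where xs: "us @ vs = map Some xs" using without_None by blast
    have "us @ vs \<in> arrangements k V" using N by (auto simp: arrangements_def)
    then have xsU: "xs \<in> arrangements k U" unfolding xs map_Some_arrangements .
    have Huv: "map H us @ map H vs = map h xs" using Hh[OF xsU] xs by (metis map_append)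
    have "S ys = (S (None # us @ vs) \<noteq> odd (length us))"
      using alternating_move[OF S_alternating] ys unfolding uv by blast
    moreover have "map h xs \<in> arrangements k (V - {a})" by (rule map_arrangements[OF xsU h])
    then have "map H us @ a # map H vs \<in> arrangements (Suc k) V"
      unfolding arrangements_Cons_move Huv using a by simp
    from alternating_move[OF S_alternating this]
    have "S (map H ys) = (S (a # map h xs) \<noteq> odd (length us))"
      unfolding uv Huv by (simp add: H(1))
    ultimately show ?thesis unfolding link[OF xsU] xs S_None by simp
  qed
qed

text \<open>A vertex of the link is sought as \<open>Some b\<close> with \<open>b\<close> given by
  \<open>extension\<close> in \<open>M\<close>. The base point \<open>None\<close> lies in
  \<open>X\<close>, so the values \<open>S (Some a # Some b # None # _)\<close> are prescribed, and
  these are the values \<open>R (a # b # _)\<close>.\<close>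

lemma link_extension_property:
  assumes a: "a \<in> U"
  shows "extension_property (k - 1) (V - {Some a}) None (\<lambda>ys. S (Some a # ys))"
proof -
  obtain m where m: "k = Suc (Suc m)" using k_ge_2 by (cases k; cases "k - 1") auto
  have even_m: "even m" using even m by simp
  text \<open>
    The triviality of the coboundary translates prescribed values \<open>S (a # b # ys)\<close> into prescribed values
    of \<open>R (b # _)\<close>: \<open>\<chi>\<close> handles the lists \<open>ys\<close> through \<open>None\<close> and \<open>\<omega>\<close> the others.
  \<close>
  have "\<exists>b \<in> (V - {Some a}) - X. \<forall>ys \<in> arrangements (Suc m) X. S (Some a # b # ys) = \<phi> ys"
    if X: "finite X" "None \<in> X" "X \<subseteq> V - {Some a}" and \<phi>: "alternating (Suc m) X \<phi>" for X \<phi>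
  proof -
    define Y where "Y = {x. Some x \<in> X}"
    have XY: "X = insert None (Some ` Y)"
      using X(2) unfolding Y_def by (auto intro: rev_image_eqI) (metis image_eqI mem_Collect_eq option.exhaust)
    have Y: "finite Y" "Y \<subseteq> U" "a \<notin> Y"
      using X(1,3) unfolding XY by (auto dest: finite_imageD)
    define \<chi> where "\<chi> zs \<longleftrightarrow> \<not> \<phi> (None # map Some zs)" for zs
    define \<omega> where "\<omega> zs \<longleftrightarrow> (\<phi> (map Some zs) \<noteq> R (a # zs)) \<noteq> (\<not> delta \<chi> zs)" for zs
    have "alternating m (X - {None}) (\<lambda>zs. \<phi> (None # zs))" by (rule alternating_Cons[OF \<phi> X(2)])
    then have "alternating m Y (\<lambda>zs. \<phi> (None # map Some zs))"
      by (rule alternating_map) (auto simp: XY)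
    then have \<chi>: "alternating m Y \<chi>" unfolding \<chi>_def by (rule alternating_not)
    have "alternating (Suc m) Y (\<lambda>zs. \<phi> (map Some zs))"
      by (rule alternating_map[OF \<phi>]) (auto simp: XY)
    moreover have "alternating (Suc m) Y (\<lambda>zs. R (a # zs))"
      using alternating_Cons[OF _ a] R_alternating Y(2,3) unfolding m
      by (blast intro: alternating_subset)
    ultimately have \<omega>: "alternating (Suc m) Y \<omega>"
      unfolding \<omega>_def
      by (intro alternating_xor3 alternating_not alternating_delta \<chi> even_m)
    \<comment> \<open>The intended link of \<open>b\<close> in \<open>M\<close>: \<chi> prescribes
      \<open>R (b # a # zs)\<close>, hence its negation relative to \<open>R (a # b # zs)\<close>,
      and \<omega> prescribes \<open>R (b # zs)\<close>, obtained by solving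
      \<open>S (Some a # Some b # map Some zs) = delta R (a # b # zs)\<close>.\<close>
    define \<psi> where "\<psi> xs = (if a \<in> set xs then insertion a \<chi> xs else \<omega> xs)" for xs
    have "alternating (Suc m) (insert a Y) \<psi>"
      unfolding \<psi>_def by (rule alternating_insertion[OF \<chi> \<omega> Y(3)])
    then obtain b where b: "b \<in> U - insert a Y"
      "\<And>ys. ys \<in> arrangements (Suc m) (insert a Y) \<Longrightarrow> R (b # ys) = \<psi> ys"
      using extension[of "insert a Y" \<psi>] Y a by (auto simp: m)
    have bYs: "R (b # zs) = \<omega> zs" if zs: "zs \<in> arrangements (Suc m) Y" for zs
    proof -
      have "zs \<in> arrangements (Suc m) (insert a Y)" using zs by (auto simp: arrangements_def)
      moreover have "a \<notin> set zs" using zs Y(3) by (auto simp: arrangements_def)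
      ultimately show ?thesis using b(2)[of zs] by (simp add: \<psi>_def)
    qed
    have baYs: "R (a # b # zs) = (\<not> \<chi> zs)" if zs: "zs \<in> arrangements m Y" for zs
    proof -
      have zs': "a # zs \<in> arrangements (Suc m) (insert a Y)"
        using zs Y(3) by (auto simp: arrangements_def)
      have "[] @ b # a # zs \<in> arrangements k U"
        using zs Y b(1) a by (auto simp: arrangements_def m)
      from alternatingD[OF R_alternating this] b(2)[OF zs'] show ?thesis by (simp add: \<psi>_def)
    qed
    have "S (Some a # Some b # ys) = \<phi> ys" if ys: "ys \<in> arrangements (Suc m) X" for ys
    proof (cases "None \<in> set ys")
      case False
      then obtain zs where zs: "ys = map Some zs" using without_None by blast
      have zsY: "zs \<in> arrangements (Suc m) Y" using ys unfolding zs XY map_Some_arrangements .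
      have "S (Some a # Some b # ys) = delta R (a # b # zs)"
        using S_Some[of "a # b # zs"] by (simp add: zs)
      also have "\<dots> = (R (b # zs) \<noteq> (R (a # zs) \<noteq> delta (\<lambda>ws. R (a # b # ws)) zs))" by simp
      also have "delta (\<lambda>ws. R (a # b # ws)) zs = delta (\<lambda>ws. \<not> \<chi> ws) zs"
        by (rule delta_cong[OF baYs zsY])
      \<comment> \<open>The length \<open>m + 1\<close> of \<open>zs\<close> is odd, so negating
        \<chi> negates its coboundary here.\<close>
      also have "\<dots> = (\<not> delta \<chi> zs)"
        using zsY even_m by (auto simp: delta_not arrangements_def)
      finally show ?thesis unfolding bYs[OF zsY] \<omega>_def zs by blast
    next
      case True
      then obtain us vs where uv: "ys = us @ None # vs" by (meson split_list)
      have N: "None # us @ vs \<in> arrangements (Suc m) X"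
        using ys unfolding uv arrangements_Cons_move .
      then have "None \<notin> set (us @ vs)" by (auto simp: arrangements_def)
      then obtain zs where zs: "us @ vs = map Some zs" using without_None by blast
      have "map Some zs \<in> arrangements m X" using N unfolding zs by (auto simp: arrangements_def)
      then have zsY: "zs \<in> arrangements m Y" unfolding XY map_Some_arrangements .
      have "Some b \<notin> X" using b(1) by (auto simp: XY)
      then have "(Some a # Some b # us) @ None # vs \<in> arrangements (Suc k) V"
        using ys X(3) a b(1) unfolding uv m by (auto simp: arrangements_def)
      \<comment> \<open>Besides \<open>us\<close>, \<open>None\<close> passes \<open>Some a\<close>
        and \<open>Some b\<close>; these two swaps cancel.\<close>
      from alternating_move[OF S_alternating this]
      have "S (Some a # Some b # ys) = (S (None # Some a # Some b # us @ vs) \<noteq> odd (length us))"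
        by (simp add: uv)
      also have "S (None # Some a # Some b # us @ vs) = R (a # b # zs)"
        using S_None[of "a # b # zs"] by (simp add: zs)
      also have "\<dots> = \<phi> (None # us @ vs)" unfolding baYs[OF zsY] \<chi>_def zs by blast
      also have "(\<phi> (None # us @ vs) \<noteq> odd (length us)) = \<phi> ys"
        using alternating_move[OF \<phi>] ys unfolding uv by blast
      finally show ?thesis .
    qed
    moreover have "Some b \<in> (V - {Some a}) - X" using b(1) by (auto simp: XY)
    ultimately show ?thesis by blast
  qed
  then show ?thesis unfolding extension_property_def m by simp
qed

text \<open>\<open>R\<close> is the link of \<open>S\<close> at \<open>None\<close>. Both links are
  countable, alternating and have the extension property, so \<open>alternating_iso\<close> applies;
  \<open>a\<close> serves as base point of \<open>U\<close>.\<close>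

lemma link_iso:
  assumes a: "a \<in> U"
  obtains h where "bij_betw h U (V - {Some a})"
    "\<And>xs. xs \<in> arrangements k U \<Longrightarrow> S (Some a # map h xs) = R xs"
proof -
  obtain n where n: "k = Suc n" "n \<ge> 1" using k_ge_2 by (cases k) auto
  have ext: "extension_property n U a R"
    unfolding extension_property_def
  proof (intro allI impI)
    fix X \<phi> assume "finite X \<and> a \<in> X \<and> X \<subseteq> U \<and> alternating n X \<phi>"
    then have "finite X" "X \<subseteq> U" "alternating (k - 1) X \<phi>" by (simp_all add: n)
    from extension[OF this] obtain b
      where "b \<in> U - X" "\<And>ys. ys \<in> arrangements n X \<Longrightarrow> R (b # ys) = \<phi> ys"
      unfolding n(1) diff_Suc_1 by blast
    then show "\<exists>b \<in> U - X. \<forall>ys \<in> arrangements n X. R (b # ys) = \<phi> ys" by blast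
  qed
  have "alternating (Suc (Suc n)) V S" using S_alternating by (simp add: n)
  from alternating_Cons[OF this, of "Some a"] a
  have link: "alternating (Suc n) (V - {Some a}) (\<lambda>ys. S (Some a # ys))" by simp
  have linkext: "extension_property n (V - {Some a}) None (\<lambda>ys. S (Some a # ys))"
    using link_extension_property[OF a] by (simp add: n)
  have "countable (V - {Some a})" using countable_U by simp
  from alternating_iso[OF countable_U this n(2) R_alternating[unfolded n(1)] ext a link linkext]
  show thesis using that unfolding n(1) by auto
qed

text \<open>Every relation symbol receives arity \<open>k + 1\<close>, and \<open>M'\<close>
  interprets all of them alike, so the construction works for any type of symbols.\<close>

definition L' :: "('g, 's) language" where
  "L' = \<lparr>fun_arity = Map.empty, rel_arity = (\<lambda>_. Some (Suc k))\<rparr>"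

definition M' :: "('g, 's, 'a option) fo_struct" where
  "M' = \<lparr>universe = V, func = undefined, rel = (\<lambda>_ ys. distinct ys \<and> S ys)\<rparr>"

lemma aut_M':
  "g \<in> aut L' M' \<longleftrightarrow> g permutes V \<and> (\<forall>ys \<in> arrangements (Suc k) V. S (map g ys) = S ys)"
proof -
  have "distinct (map g ys) = distinct ys" if "g permutes V" for ys
    using permutes_inj[OF that] by (simp add: distinct_map inj_on_def inj_def)
  then show ?thesis by (auto simp: aut_iff_preserves L'_def M'_def arrangements_tuples)
qed

text \<open>An automorphism fixing \<open>None\<close> preserves the link there, which is
  \<open>R\<close>. Conversely \<open>map_option f\<close> preserves \<open>S\<close> by
  \<open>S_preserved\<close> with \<open>a = None\<close>.\<close>

lemma restrict_stabilizer:
  "restrict_old ` {g \<in> aut (L' :: ('g, 's) language) M'. g None = None} = aut L M"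
proof (intro equalityI subsetI)
  fix f assume "f \<in> restrict_old ` {g \<in> aut (L' :: ('g, 's) language) M'. g None = None}"
  then obtain g where g: "g \<in> aut (L' :: ('g, 's) language) M'" "g None = None" and f: "f = restrict_old g"
    by blast
  then have gp: "g permutes V" by (simp only: aut_M')
  note fix_None = aut_fixing_None[OF gp g(2)]
  have "R (map f xs) = R xs" if xs: "xs \<in> arrangements k U" for xs
  proof -
    have "map Some xs \<in> arrangements k (V - {None})"
      using xs by (auto simp: arrangements_def distinct_map)
    then have arr: "None # map Some xs \<in> arrangements (Suc k) V" by simp
    have "map g (None # map Some xs) = None # map Some (map f xs)"
      using fix_None(1) g(2) f by simp
    moreover have "S (map g (None # map Some xs)) = S (None # map Some xs)"
      using g(1) arr unfolding aut_M' by blast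
    ultimately show ?thesis unfolding S_None by (simp only: S_None)
  qed
  then show "f \<in> aut L M" using fix_None(2) unfolding aut_iff f by blast
next
  fix f assume f: "f \<in> aut L M"
  then have fp: "f permutes U" by (rule aut_permutes)
  have "map_option f permutes V"
  proof (rule bij_imp_permutes)
    show "bij_betw (map_option f) V V"
      using permutes_inj[OF fp] permutes_image[OF fp]
      by (auto simp: bij_betw_def inj_on_def inj_def image_iff) (metis imageE option.simps(9))+
    show "map_option f y = y" if "y \<notin> V" for y
      using that permutes_not_in[OF fp] by (cases y) auto
  qed
  moreover have "S (map (map_option f) ys) = S ys" if ys: "ys \<in> arrangements (Suc k) V" for ys
  proof (rule S_preserved[where a = None and h = "\<lambda>x. Some (f x)", OF _ _ _ _ _ _ ys])
    fix xs assume xs: "xs \<in> arrangements k U"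
    have "S (None # map (\<lambda>x. Some (f x)) xs) = R (map f xs)"
      using S_None[of "map f xs"] by (simp add: comp_def)
    then show "S (None # map (\<lambda>x. Some (f x)) xs) = R xs" using f xs unfolding aut_iff by blast
  qed (use permutes_inj[OF fp] permutes_in_image[OF fp] in \<open>auto simp: inj_on_def inj_def\<close>)
  ultimately have stab: "map_option f \<in> {g \<in> aut (L' :: ('g, 's) language) M'. g None = None}"
    by (simp add: aut_M')
  have "restrict_old (map_option f) = f" by (simp add: restrict_old_def)
  with imageI[OF stab, of restrict_old] show "f \<in> restrict_old ` {g \<in> aut (L' :: ('g, 's) language) M'. g None = None}"
    by simp
qed

text \<open>For \<open>y = Some a\<close>, the map sending \<open>None\<close> to
  \<open>Some a\<close> and acting on old points as the isomorphism of \<open>link_iso\<close>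
  preserves \<open>S\<close>; it is the identity off \<open>V\<close>, as \<open>permutes\<close>
  demands.\<close>

lemma moves_None:
  assumes "y \<in> V"
  obtains g where "g \<in> aut (L' :: ('g, 's) language) M'" "g None = y"
proof (cases y)
  case None
  then show thesis using that[of id] by (simp add: aut_M' permutes_id)
next
  case (Some a)
  then have a: "a \<in> U" using assms by auto
  obtain h where h: "bij_betw h U (V - {Some a})"
    "\<And>xs. xs \<in> arrangements k U \<Longrightarrow> S (Some a # map h xs) = R xs"
    using link_iso[OF a] by blast
  define H where "H y = (case y of None \<Rightarrow> Some a | Some x \<Rightarrow> if x \<in> U then h x else y)" for y
  have HU: "H (Some x) = h x" if "x \<in> U" for x using that by (simp add: H_def)
  have "H permutes V"
  proof (rule bij_imp_permutes)
    have "bij_betw H (Some ` U) (V - {Some a})"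
    proof -
      have "bij_betw (h \<circ> the) (Some ` U) (V - {Some a})"
        using h(1) by (rule bij_betw_trans[rotated]) (auto simp: bij_betw_def inj_on_def image_image)
      then show ?thesis by (rule bij_betw_cong[THEN iffD1, rotated]) (auto simp: HU)
    qed
    moreover have "bij_betw H {None} {Some a}" by (simp add: H_def)
    ultimately have "bij_betw H ({None} \<union> Some ` U) ({Some a} \<union> (V - {Some a}))"
      by (intro bij_betw_combine) auto
    moreover have "{Some a} \<union> (V - {Some a}) = V" using a by auto
    ultimately show "bij_betw H V V" by simp
    show "H y = y" if "y \<notin> V" for y
      using that by (cases y) (auto simp: H_def)
  qed
  moreover have "S (map H ys) = S ys" if ys: "ys \<in> arrangements (Suc k) V" for ys
  proof (rule S_preserved[OF _ _ _ h(2) _ HU ys])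
    show "inj_on h U" "h ` U \<subseteq> V - {Some a}" using h(1) by (auto simp: bij_betw_def)
  qed (use a in \<open>auto simp: H_def\<close>)
  ultimately have "H \<in> aut (L' :: ('g, 's) language) M'" by (simp add: aut_M')
  moreover have "H None = y" by (simp add: H_def Some)
  ultimately show thesis by (rule that)
qed

lemma transitive_extension_M': "transitive_extension L M (L' :: ('g, 's) language) M'"
  unfolding transitive_extension_def one_point_extension_def
proof (intro conjI ballI)
  show "is_structure (L' :: ('g, 's) language) M'"
    by (simp add: is_structure_def fun_closed_def L'_def)
  have univ: "universe (M' :: ('g, 's, 'a option) fo_struct) = V" by (simp add: M'_def)
  then show "universe (M' :: ('g, 's, 'a option) fo_struct) = insert None (Some ` U)" .
  show "restrict_old ` {g \<in> aut (L' :: ('g, 's) language) M'. g None = None} = aut L M"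
    by (rule restrict_stabilizer)
  fix x y assume "x \<in> universe (M' :: ('g, 's, 'a option) fo_struct)"
    "y \<in> universe (M' :: ('g, 's, 'a option) fo_struct)"
  then obtain g h where g: "g \<in> aut (L' :: ('g, 's) language) M'" "g None = x"
    and h: "h \<in> aut (L' :: ('g, 's) language) M'" "h None = y"
    unfolding univ using moves_None by metis
  have "(h \<circ> inv g) x = y"
    using permutes_inverses(2)[OF aut_permutes[OF g(1)]] g(2) h(2) by auto
  then show "\<exists>f \<in> aut (L' :: ('g, 's) language) M'. f x = y"
    using aut_comp[OF h(1) aut_inv[OF g(1)]] by blast
qed

end

theorem theorem2:
  fixes k :: nat and M :: "(unit, unit, 'a) fo_struct"
  assumes "k \<ge> 2" and "generic_orientation k M"
  shows "(\<exists>(L' :: ('g, 's) language) (M' :: ('g, 's, 'a option) fo_struct).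
            transitive_extension (orientation_language k) M L' M') \<longleftrightarrow> even k"
proof
  assume "\<exists>(L' :: ('g, 's) language) (M' :: ('g, 's, 'a option) fo_struct).
            transitive_extension (orientation_language k) M L' M'"
  then obtain L' :: "('g, 's) language" and M' :: "('g, 's, 'a option) fo_struct"
    where "transitive_extension (orientation_language k) M L' M'" by blast
  with assms interpret transitive_extension_generic k M L' M' by unfold_locales
  show "even k" by (rule even_k)
next
  assume "even k"
  with assms interpret generic_even_orientation k M by unfold_locales
  show "\<exists>(L' :: ('g, 's) language) (M' :: ('g, 's, 'a option) fo_struct).
            transitive_extension (orientation_language k) M L' M'"
    using transitive_extension_M' by blast
qed

end
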